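(* Let $\pi:(X,T)\to(Y,T)$ be an almost proximal extension of minimal flows. Then there exist minimal flows $(X',T)$, $(Y',T)$ and extensions $\sigma':X'\to X$, $\tau':Y'\to Y$, $\pi':X'\to Y'$ with $\pi\circ\sigma'=\tau'\circ\pi'$, such that $\sigma'$ and $\tau'$ are proximal and $\pi'$ is a finite to one equicontinuous extension. Moreover, $\pi$ is almost finite to one if and only if $\tau'$ and $\sigma'$ are almost one to one.
   Context: $T$ is an infinite countable discrete group. A flow $(X,T)$ is a compact metric space $(X,d)$ with a continuous action of $T$; it is minimal if every orbit is dense. A point of a flow is minimal if its orbit closure is a minimal flow. An extension $\pi:(X,T)\to(Y,T)$ is a continuous surjective $T$-equivariant map. Powers $X^n$ carry the diagonal action. A subset $A\subseteq X$ is an almost periodic set if for every finite subset $\{x_1,\dots,x_n\}$ of $A$ the point $(x_1,\dots,x_n)$ is a minimal point of $(X^n,T)$. An extension $\pi$ of minimal flows is almost proximal if for each $y\in Y$ there is $N\in\mathbb{N}$ such that every almost periodic subset of $\pi^{-1}(y)$ has cardinality at most $N$. A pair $(x,x')$ is proximal if $\inf_{t\in T}d(tx,tx')=0$; $\pi$ is proximal if $(x,x')$ is proximal whenever $\pi(x)=\pi(x')$. $\pi$ is equicontinuous if for every $\epsilon>0$ there is $\delta>0$ such that $\pi(x_1)=\pi(x_2)$ and $d(x_1,x_2)<\delta$ imply $d(tx_1,tx_2)<\epsilon$ for all $t\in T$. $\pi$ is finite to one if every fiber is finite, and almost finite to one if some fiber is finite. $\pi$ is almost one to one if there is a dense $G_\delta$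 set $X_0\subseteq X$ such that $\pi^{-1}(\{\pi(x)\})=\{x\}$ for all $x\in X_0$. *)

theory Defs
  imports "HOL-Analysis.Analysis" "HOL-Algebra.Group_Action"
begin

text \<open>
  The acting group is discrete, so continuity of the action means that every group element acts
  continuously. Phase spaces are nonempty: otherwise the empty flow would be minimal, and its
  identity map almost one to one without having any finite fiber.
\<close>

definition flow ::
  "('t, 'm) monoid_scheme \<Rightarrow> 'a metric \<Rightarrow> ('t \<Rightarrow> 'a \<Rightarrow> 'a) \<Rightarrow> bool" where
  "flow T X \<phi> \<longleftrightarrow>
     mspace X \<noteq> {} \<and> compact_space (mtopology_of X) \<and> group_action T (mspace X) \<phi> \<and>
     (\<forall>t\<in>carrier T. continuous_map (mtopology_of X) (mtopology_of X) (\<phi> t))"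

text \<open>
  Minimality depends on the topology only; stating it for topologies lets it apply to powers and
  orbit closures without choosing metrics on them.
\<close>

definition minimal_action ::
  "('t, 'm) monoid_scheme \<Rightarrow> 'a topology \<Rightarrow> ('t \<Rightarrow> 'a \<Rightarrow> 'a) \<Rightarrow> bool" where
  "minimal_action T \<tau> \<phi> \<longleftrightarrow>
     (\<forall>x\<in>topspace \<tau>. \<tau> closure_of (orbit T \<phi> x) = topspace \<tau>)"

definition minimal_point ::
  "('t, 'm) monoid_scheme \<Rightarrow> 'a topology \<Rightarrow> ('t \<Rightarrow> 'a \<Rightarrow> 'a) \<Rightarrow> 'a \<Rightarrow> bool" where
  "minimal_point T \<tau> \<phi> x \<longleftrightarrow> x \<in> topspace \<tau> \<and>
     minimal_action T (subtopology \<tau> (\<tau> closure_of (orbit T \<phi> x))) \<phi>"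

definition minimal_flow ::
  "('t, 'm) monoid_scheme \<Rightarrow> 'a metric \<Rightarrow> ('t \<Rightarrow> 'a \<Rightarrow> 'a) \<Rightarrow> bool" where
  "minimal_flow T X \<phi> \<longleftrightarrow> flow T X \<phi> \<and> minimal_action T (mtopology_of X) \<phi>"

text \<open>Points of the power with exponent \<open>n\<close> are extensional functions on \<open>{..<n}\<close>.\<close>

definition power_top :: "nat \<Rightarrow> 'a metric \<Rightarrow> (nat \<Rightarrow> 'a) topology" where
  "power_top n X = product_topology (\<lambda>_. mtopology_of X) {..<n}"

definition diag_action ::
  "nat \<Rightarrow> ('t \<Rightarrow> 'a \<Rightarrow> 'a) \<Rightarrow> 't \<Rightarrow> (nat \<Rightarrow> 'a) \<Rightarrow> (nat \<Rightarrow> 'a)" where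
  "diag_action n \<phi> t x = (\<lambda>i\<in>{..<n}. \<phi> t (x i))"

definition almost_periodic_set ::
  "('t, 'm) monoid_scheme \<Rightarrow> 'a metric \<Rightarrow> ('t \<Rightarrow> 'a \<Rightarrow> 'a) \<Rightarrow> 'a set \<Rightarrow> bool" where
  "almost_periodic_set T X \<phi> A \<longleftrightarrow> A \<subseteq> mspace X \<and>
     (\<forall>n. \<forall>x \<in> {..<n} \<rightarrow>\<^sub>E A. minimal_point T (power_top n X) (diag_action n \<phi>) x)"

definition extension ::
  "('t, 'm) monoid_scheme \<Rightarrow> 'a metric \<Rightarrow> ('t \<Rightarrow> 'a \<Rightarrow> 'a) \<Rightarrow>
   'b metric \<Rightarrow> ('t \<Rightarrow> 'b \<Rightarrow> 'b) \<Rightarrow> ('a \<Rightarrow> 'b) \<Rightarrow> bool" where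
  "extension T X \<phi> Y \<psi> \<pi> \<longleftrightarrow>
     continuous_map (mtopology_of X) (mtopology_of Y) \<pi> \<and> \<pi> ` mspace X = mspace Y \<and>
     (\<forall>t\<in>carrier T. \<forall>x\<in>mspace X. \<pi> (\<phi> t x) = \<psi> t (\<pi> x))"

definition fiber :: "'a metric \<Rightarrow> ('a \<Rightarrow> 'b) \<Rightarrow> 'b \<Rightarrow> 'a set" where
  "fiber X \<pi> y = {x \<in> mspace X. \<pi> x = y}"

definition almost_proximal ::
  "('t, 'm) monoid_scheme \<Rightarrow> 'a metric \<Rightarrow> ('t \<Rightarrow> 'a \<Rightarrow> 'a) \<Rightarrow> 'b metric \<Rightarrow> ('a \<Rightarrow> 'b) \<Rightarrow> bool" where
  "almost_proximal T X \<phi> Y \<pi> \<longleftrightarrow>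
     (\<forall>y\<in>mspace Y. \<exists>N::nat. \<forall>A. A \<subseteq> fiber X \<pi> y \<and> almost_periodic_set T X \<phi> A \<longrightarrow>
        finite A \<and> card A \<le> N)"

definition proximal_pair ::
  "('t, 'm) monoid_scheme \<Rightarrow> 'a metric \<Rightarrow> ('t \<Rightarrow> 'a \<Rightarrow> 'a) \<Rightarrow> 'a \<Rightarrow> 'a \<Rightarrow> bool" where
  "proximal_pair T X \<phi> x x' \<longleftrightarrow> (INF t\<in>carrier T. mdist X (\<phi> t x) (\<phi> t x')) = 0"

definition proximal_map ::
  "('t, 'm) monoid_scheme \<Rightarrow> 'a metric \<Rightarrow> ('t \<Rightarrow> 'a \<Rightarrow> 'a) \<Rightarrow> ('a \<Rightarrow> 'b) \<Rightarrow> bool" where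
  "proximal_map T X \<phi> \<pi> \<longleftrightarrow>
     (\<forall>x\<in>mspace X. \<forall>x'\<in>mspace X. \<pi> x = \<pi> x' \<longrightarrow> proximal_pair T X \<phi> x x')"

definition equicontinuous_map ::
  "('t, 'm) monoid_scheme \<Rightarrow> 'a metric \<Rightarrow> ('t \<Rightarrow> 'a \<Rightarrow> 'a) \<Rightarrow> ('a \<Rightarrow> 'b) \<Rightarrow> bool" where
  "equicontinuous_map T X \<phi> \<pi> \<longleftrightarrow>
     (\<forall>\<epsilon>>0. \<exists>\<delta>>0. \<forall>x1\<in>mspace X. \<forall>x2\<in>mspace X. \<pi> x1 = \<pi> x2 \<and> mdist X x1 x2 < \<delta> \<longrightarrow>
        (\<forall>t\<in>carrier T. mdist X (\<phi> t x1) (\<phi> t x2) < \<epsilon>))"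

definition finite_to_one :: "'a metric \<Rightarrow> 'b metric \<Rightarrow> ('a \<Rightarrow> 'b) \<Rightarrow> bool" where
  "finite_to_one X Y \<pi> \<longleftrightarrow> (\<forall>y\<in>mspace Y. finite (fiber X \<pi> y))"

definition almost_finite_to_one :: "'a metric \<Rightarrow> 'b metric \<Rightarrow> ('a \<Rightarrow> 'b) \<Rightarrow> bool" where
  "almost_finite_to_one X Y \<pi> \<longleftrightarrow> (\<exists>y\<in>mspace Y. finite (fiber X \<pi> y))"

definition almost_one_to_one :: "'a metric \<Rightarrow> ('a \<Rightarrow> 'b) \<Rightarrow> bool" where
  "almost_one_to_one X \<pi> \<longleftrightarrow>
     (\<exists>X0. gdelta_in (mtopology_of X) X0 \<and> mtopology_of X closure_of X0 = mspace X \<and>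
        (\<forall>x\<in>X0. fiber X \<pi> (\<pi> x) = {x}))"

end

theory Submission
  imports Defs
begin

text \<open>
  Let \<open>N\<close> be the largest size of an almost periodic set in one fiber of \<open>\<pi>\<close>, and let \<open>M\<close> be the orbit
  closure, in the power with exponent \<open>N\<close>, of an enumeration of such a set. Then \<open>M\<close> is minimal and
  consists of injective tuples lying in fibers of \<open>\<pi>\<close>. Forgetting the order of the coordinates gives
  \<open>Y'\<close>; forgetting it except for the first coordinate gives \<open>X'\<close>. The map from \<open>X'\<close> to \<open>Y'\<close> has fibers
  of size at most \<open>N\<close>, and the points of one fiber are uniformly separated, whence equicontinuity.
  Given tuples in \<open>M\<close> over a common point of \<open>Y\<close>, a minimal point in the orbit closure of their
  concatenation has as coordinates an almost periodic set in one fiber, which has at most \<open>N\<close> elements,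
  so all tuples collapse to the same set. For two tuples this is proximality; for the finitely many
  tuples over a point with finite fiber it contracts a whole fiber of \<open>\<tau>'\<close>, and the Baire category
  theorem then yields a singleton fiber, which by minimality spreads along a dense orbit.
\<close>

subsection \<open>Minimal sets of topological actions\<close>

definition invariant_set :: "('t, 'm) monoid_scheme \<Rightarrow> ('t \<Rightarrow> 'a \<Rightarrow> 'a) \<Rightarrow> 'a set \<Rightarrow> bool" where
  "invariant_set T \<alpha> S \<longleftrightarrow> (\<forall>t\<in>carrier T. \<forall>x\<in>S. \<alpha> t x \<in> S)"

text \<open>Minimality is taken inside the ambient space, under inclusion among nonempty closed
  invariant sets. This form passes to images and intersections without changing the topology;
  \<open>minimal_set_minimal_action\<close> and \<open>minimal_action_minimal_set\<close> translate
  it.\<close>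

definition minimal_set ::
  "('t, 'm) monoid_scheme \<Rightarrow> 'a topology \<Rightarrow> ('t \<Rightarrow> 'a \<Rightarrow> 'a) \<Rightarrow> 'a set \<Rightarrow> bool" where
  "minimal_set T W \<alpha> K \<longleftrightarrow> K \<noteq> {} \<and> closedin W K \<and> invariant_set T \<alpha> K \<and>
     (\<forall>L\<subseteq>K. L \<noteq> {} \<and> closedin W L \<and> invariant_set T \<alpha> L \<longrightarrow> L = K)"

lemma minimal_setD:
  assumes "minimal_set T W \<alpha> K"
  shows "K \<noteq> {}" "closedin W K" "invariant_set T \<alpha> K" "K \<subseteq> topspace W"
  using assms closedin_subset unfolding minimal_set_def by blast+

lemma minimal_setD_eq:
  assumes "minimal_set T W \<alpha> K" "L \<subseteq> K" "L \<noteq> {}" "closedin W L" "invariant_set T \<alpha> L"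
  shows "L = K"
  using assms unfolding minimal_set_def by blast

text \<open>The part of \<open>K\<close> inside \<open>C\<close> is again nonempty, closed and
  invariant. Thus a closed invariant condition that holds at one point of a minimal set holds on all
  of it.\<close>

lemma minimal_set_subset:
  assumes K: "minimal_set T W \<alpha> K" and C: "closedin W C" "invariant_set T \<alpha> C" and "K \<inter> C \<noteq> {}"
  shows "K \<subseteq> C"
proof -
  have "K \<inter> C = K"
    using assms minimal_setD[OF K]
    by (intro minimal_setD_eq[OF K]) (auto simp: invariant_set_def)
  then show ?thesis by blast
qed

text \<open>Separates the dynamics from \<open>flow\<close>, so that powers and invariant subspaces
  are instances: \<open>group_action\<close> also asks for maps extensional on the space, which the
  coordinatewise action on a power does not provide.\<close>

locale topological_action = group T for T :: "('t, 'm) monoid_scheme" (structure) +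
  fixes W :: "'a topology" and \<alpha> :: "'t \<Rightarrow> 'a \<Rightarrow> 'a"
  assumes cont: "t \<in> carrier T \<Longrightarrow> continuous_map W W (\<alpha> t)"
    and act_one: "x \<in> topspace W \<Longrightarrow> \<alpha> \<one> x = x"
    and act_mult: "\<lbrakk>s \<in> carrier T; t \<in> carrier T; x \<in> topspace W\<rbrakk> \<Longrightarrow> \<alpha> (s \<otimes> t) x = \<alpha> s (\<alpha> t x)"
begin

lemma act_closed: "\<lbrakk>t \<in> carrier T; x \<in> topspace W\<rbrakk> \<Longrightarrow> \<alpha> t x \<in> topspace W"
  using cont continuous_map_image_subset_topspace by blast

lemma act_inv: "\<lbrakk>t \<in> carrier T; x \<in> topspace W\<rbrakk> \<Longrightarrow> \<alpha> (inv t) (\<alpha> t x) = x"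
  using act_mult[of "inv t" t x] act_one by simp

lemma act_inv': "\<lbrakk>t \<in> carrier T; x \<in> topspace W\<rbrakk> \<Longrightarrow> \<alpha> t (\<alpha> (inv t) x) = x"
  using act_mult[of t "inv t" x] act_one by simp

lemma orbit_subset: "x \<in> topspace W \<Longrightarrow> orbit T \<alpha> x \<subseteq> topspace W"
  using act_closed by (auto simp: orbit_def)

lemma orbit_refl: "x \<in> topspace W \<Longrightarrow> x \<in> orbit T \<alpha> x"
  unfolding orbit_def using act_one by force

lemma orbit_invariant: "x \<in> topspace W \<Longrightarrow> invariant_set T \<alpha> (orbit T \<alpha> x)"
  unfolding invariant_set_def orbit_def using act_mult[symmetric] by auto

lemma closure_invariant:
  assumes "invariant_set T \<alpha> S" "S \<subseteq> topspace W"
  shows "invariant_set T \<alpha> (W closure_of S)"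
  unfolding invariant_set_def
proof (intro ballI)
  fix t x assume t: "t \<in> carrier T" and x: "x \<in> W closure_of S"
  have "\<alpha> t ` S \<subseteq> S" using assms t by (auto simp: invariant_set_def)
  moreover have "\<alpha> t x \<in> W closure_of (\<alpha> t ` S)"
    using continuous_map_image_closure_subset[OF cont[OF t]] x by blast
  ultimately show "\<alpha> t x \<in> W closure_of S" using closure_of_mono by blast
qed

lemma orbit_closure:
  assumes "x \<in> topspace W"
  shows "closedin W (W closure_of (orbit T \<alpha> x))" "invariant_set T \<alpha> (W closure_of (orbit T \<alpha> x))"
    "x \<in> W closure_of (orbit T \<alpha> x)"
  using assms closure_invariant[OF orbit_invariant orbit_subset] orbit_refl[OF assms]
    closure_of_subset[OF orbit_subset[OF assms]]
  by auto

lemma orbit_closure_minimal: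
  assumes "closedin W C" "invariant_set T \<alpha> C" "x \<in> C"
  shows "W closure_of (orbit T \<alpha> x) \<subseteq> C"
  using assms by (intro closure_of_minimal) (auto simp: orbit_def invariant_set_def)

lemma minimal_set_orbit_closure:
  assumes K: "minimal_set T W \<alpha> K" and x: "x \<in> K"
  shows "W closure_of (orbit T \<alpha> x) = K"
proof -
  have xW: "x \<in> topspace W" using minimal_setD[OF K] x by blast
  show ?thesis
    using orbit_closure[OF xW] orbit_closure_minimal[OF _ _ x] minimal_setD[OF K]
    by (intro minimal_setD_eq[OF K]) auto
qed

lemma minimal_set_minimal_action:
  assumes K: "minimal_set T W \<alpha> K"
  shows "minimal_action T (subtopology W K) \<alpha>"
  unfolding minimal_action_def
proof
  fix x assume "x \<in> topspace (subtopology W K)"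
  then have x: "x \<in> K" by simp
  have "orbit T \<alpha> x \<subseteq> K"
    using minimal_setD[OF K] x by (auto simp: orbit_def invariant_set_def)
  then show "subtopology W K closure_of orbit T \<alpha> x = topspace (subtopology W K)"
    using minimal_set_orbit_closure[OF K x] minimal_setD[OF K]
    by (simp add: closure_of_subtopology inf_absorb2)
qed

lemma minimal_set_minimal_point:
  assumes "minimal_set T W \<alpha> K" "x \<in> K"
  shows "minimal_point T W \<alpha> x"
  using assms minimal_setD(4)[OF assms(1)] minimal_set_minimal_action[OF assms(1)]
  by (auto simp: minimal_point_def minimal_set_orbit_closure)

lemma minimal_action_minimal_set:
  assumes K: "closedin W K" "invariant_set T \<alpha> K" "K \<noteq> {}"
    and min: "minimal_action T (subtopology W K) \<alpha>"
  shows "minimal_set T W \<alpha> K"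
  unfolding minimal_set_def
proof (intro conjI allI impI K)
  fix L assume LK: "L \<subseteq> K" and L: "L \<noteq> {} \<and> closedin W L \<and> invariant_set T \<alpha> L"
  then obtain x where x: "x \<in> L" by blast
  have KW: "K \<subseteq> topspace W" using K closedin_subset by blast
  have "subtopology W K closure_of (orbit T \<alpha> x) = K"
    using min x LK KW unfolding minimal_action_def by (auto simp: Int_absorb1)
  then have "K \<subseteq> W closure_of (orbit T \<alpha> x)"
    using closure_of_subtopology_subset by metis
  then show "L = K" using orbit_closure_minimal[of L x] L x LK by blast
qed

lemma minimal_point_minimal_set:
  assumes "minimal_point T W \<alpha> x"
  shows "minimal_set T W \<alpha> (W closure_of (orbit T \<alpha> x))"
  using assms orbit_closure[of x] unfolding minimal_point_def
  by (intro minimal_action_minimal_set) auto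

lemma minimal_action_topspace:
  assumes "minimal_action T W \<alpha>" "topspace W \<noteq> {}"
  shows "minimal_set T W \<alpha> (topspace W)"
  using assms act_closed by (intro minimal_action_minimal_set) (auto simp: invariant_set_def)

text \<open>Zorn's lemma is applied to complements: open sets with invariant complement that do not
  cover \<open>C\<close>. By compactness the union of a chain still fails to cover \<open>C\<close>,
  and what a maximal such set leaves of \<open>C\<close> is minimal.\<close>

lemma minimal_set_exists:
  assumes W: "compact_space W" and C: "closedin W C" "invariant_set T \<alpha> C" "C \<noteq> {}"
  obtains K where "K \<subseteq> C" "minimal_set T W \<alpha> K"
proof -
  define \<A> where "\<A> = {U. openin W U \<and> invariant_set T \<alpha> (topspace W - U) \<and> \<not> C \<subseteq> U}"
  have CW: "C \<subseteq> topspace W" using C closedin_subset by blast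
  have invI: "invariant_set T \<alpha> (C - U)" if "U \<in> \<A>" for U
    using that C CW by (auto simp: \<A>_def invariant_set_def)
  have "\<exists>M\<in>\<A>. \<forall>X\<in>\<A>. M \<subseteq> X \<longrightarrow> X = M"
  proof (rule subset_Zorn_nonempty)
    have "{} \<in> \<A>" using C act_closed by (auto simp: \<A>_def invariant_set_def)
    then show "\<A> \<noteq> {}" by blast
  next
    fix \<C> assume ne: "\<C> \<noteq> {}" and ch: "subset.chain \<A> \<C>"
    then have sub: "\<C> \<subseteq> \<A>" and lin: "\<And>A B. \<lbrakk>A \<in> \<C>; B \<in> \<C>\<rbrakk> \<Longrightarrow> A \<subseteq> B \<or> B \<subseteq> A"
      by (auto simp: subset.chain_def)
    have "\<not> C \<subseteq> \<Union>\<C>"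
    proof
      assume "C \<subseteq> \<Union>\<C>"
      moreover have "compactin W C" using C W closedin_compact_space by blast
      ultimately obtain \<F> where \<F>: "finite \<F>" "\<F> \<subseteq> \<C>" "C \<subseteq> \<Union>\<F>"
        using sub unfolding compactin_def \<A>_def by (metis (no_types, lifting) mem_Collect_eq subset_iff)
      have "\<F> \<noteq> {}" using \<F> C by blast
      moreover have "subset.chain \<C> \<F>"
        using \<F>(2) lin by (auto simp: subset.chain_def)
      ultimately have "\<Union>\<F> \<in> \<F>"
        using \<F>(1) Union_in_chain by blast
      then show False using \<F> sub by (auto simp: \<A>_def)
    qed
    moreover have "invariant_set T \<alpha> (topspace W - \<Union>\<C>)"
      using sub ne by (fastforce simp: \<A>_def invariant_set_def)
    ultimately show "\<Union>\<C> \<in> \<A>" using sub by (auto simp: \<A>_def)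
  qed
  then obtain M where M: "M \<in> \<A>" and max: "\<And>X. \<lbrakk>X \<in> \<A>; M \<subseteq> X\<rbrakk> \<Longrightarrow> X = M" by blast
  have "minimal_set T W \<alpha> (C - M)"
    unfolding minimal_set_def
  proof (intro conjI allI impI)
    show "C - M \<noteq> {}" using M by (auto simp: \<A>_def)
    show "closedin W (C - M)" using M C by (auto simp: \<A>_def)
    show "invariant_set T \<alpha> (C - M)" using invI[OF M] .
  next
    fix L assume L: "L \<subseteq> C - M" "L \<noteq> {} \<and> closedin W L \<and> invariant_set T \<alpha> L"
    then have LW: "L \<subseteq> topspace W" using CW by blast
    have "topspace W - L \<in> \<A>"
      using L LW by (auto simp: \<A>_def Diff_Diff_Int inf_absorb2)
    moreover have "M \<subseteq> topspace W - L" using L M by (auto simp: \<A>_def dest: openin_subset)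
    ultimately have "topspace W - L = M" using max by blast
    then show "L = C - M" using L CW by blast
  qed
  then show ?thesis using that by blast
qed

lemma orbit_meets_open:
  assumes "z \<in> W closure_of (orbit T \<alpha> x)" "openin W U" "z \<in> U"
  obtains t where "t \<in> carrier T" "\<alpha> t x \<in> U"
  using assms unfolding in_closure_of orbit_def by blast

end

text \<open>The image is compact, hence closed in a Hausdorff space. A nonempty closed invariant
  \<open>L\<close> in the image pulls back to a nonempty closed invariant part of \<open>K\<close>,
  which must be all of \<open>K\<close>.\<close>

lemma minimal_set_image:
  assumes W: "compact_space W" "Hausdorff_space W'" and f: "continuous_map W W' f"
    and eq: "\<And>t x. \<lbrakk>t \<in> carrier T; x \<in> topspace W\<rbrakk> \<Longrightarrow> f (\<alpha> t x) = \<beta> t (f x)"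
    and K: "minimal_set T W \<alpha> K"
  shows "minimal_set T W' \<beta> (f ` K)"
  unfolding minimal_set_def
proof (intro conjI allI impI)
  note KD = minimal_setD[OF K]
  show "f ` K \<noteq> {}" using KD by blast
  show "closedin W' (f ` K)"
    using W KD f closedin_compact_space image_compactin compactin_imp_closedin by metis
  show "invariant_set T \<beta> (f ` K)"
    unfolding invariant_set_def
  proof clarify
    fix t x assume t: "t \<in> carrier T" and x: "x \<in> K"
    then have "\<beta> t (f x) = f (\<alpha> t x)" using eq KD(4) by auto
    moreover have "\<alpha> t x \<in> K" using KD(3) t x by (auto simp: invariant_set_def)
    ultimately show "\<beta> t (f x) \<in> f ` K" by blast
  qed
  fix L assume L: "L \<subseteq> f ` K" "L \<noteq> {} \<and> closedin W' L \<and> invariant_set T \<beta> L"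
  define C where "C = {x \<in> topspace W. f x \<in> L}"
  have C: "closedin W C"
    unfolding C_def using closedin_continuous_map_preimage[OF f] L by blast
  have "K \<inter> C = K"
  proof (rule minimal_setD_eq[OF K])
    show "K \<inter> C \<noteq> {}" using L KD(4) unfolding C_def by blast
    show "closedin W (K \<inter> C)" using KD C by blast
    show "invariant_set T \<alpha> (K \<inter> C)"
      using KD(3,4) L eq unfolding invariant_set_def C_def by (simp add: subset_iff)
  qed auto
  then show "L = f ` K" using L unfolding C_def by blast
qed

subsection \<open>Powers, extensions and factors\<close>

lemma Hausdorff_space_mtopology_of: "Hausdorff_space (mtopology_of m)"
  by (simp add: Metric_space.Hausdorff_space_mtopology Metric_space_mspace_mdist mtopology_of_def)

lemma flow_topological_action:
  assumes "group T" "flow T X \<phi>"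
  shows "topological_action T (mtopology_of X) \<phi>"
proof -
  interpret group T by fact
  interpret A: group_action T "mspace X" \<phi> using assms by (simp add: flow_def)
  show ?thesis
  proof
    show "\<phi> \<one>\<^bsub>T\<^esub> x = x" if "x \<in> topspace (mtopology_of X)" for x
      using that fun_cong[OF A.id_eq_one, of x] by simp
  qed (use assms A.composition_rule in \<open>auto simp: flow_def\<close>)
qed

text \<open>Inverses in the group make each \<open>\<phi> t\<close> a bijection; \<open>ext\<close>
  supplies the rest of membership in \<open>Bij\<close>.\<close>

lemma topological_actionI_flow:
  assumes T: "topological_action T (mtopology_of X) \<phi>"
    and "compact_space (mtopology_of X)" "mspace X \<noteq> {}"
    and ext: "\<And>t. t \<in> carrier T \<Longrightarrow> \<phi> t \<in> extensional (mspace X)"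
  shows "flow T X \<phi>"
proof -
  interpret topological_action T "mtopology_of X" \<phi> by fact
  have Bij: "\<phi> t \<in> Bij (mspace X)" if t: "t \<in> carrier T" for t
  proof -
    have "bij_betw (\<phi> t) (mspace X) (mspace X)"
      using t act_inv act_inv' act_closed
      by (intro bij_betw_byWitness[where f' = "\<phi> (inv\<^bsub>T\<^esub> t)"]) auto
    then show ?thesis using ext[OF t] by (simp add: Bij_def)
  qed
  have "\<phi> (s \<otimes>\<^bsub>T\<^esub> t) = compose (mspace X) (\<phi> s) (\<phi> t)" if "s \<in> carrier T" "t \<in> carrier T" for s t
    using that ext[of "s \<otimes>\<^bsub>T\<^esub> t"] act_mult
    by (auto simp: compose_def extensional_def fun_eq_iff)
  then have "\<phi> \<in> hom T (BijGroup (mspace X))"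
    using Bij by (auto simp: hom_def BijGroup_def)
  then have "group_action T (mspace X) \<phi>"
    by (auto simp: group_action_def group_hom_def group_hom_axioms_def group_BijGroup is_group)
  then show ?thesis using assms cont by (simp add: flow_def)
qed

section \<open>Invariant subspaces and powers of an action\<close>

context topological_action
begin

lemma subtopology_action:
  assumes "invariant_set T \<alpha> K"
  shows "topological_action T (subtopology W K) \<alpha>"
proof unfold_locales
  show "continuous_map (subtopology W K) (subtopology W K) (\<alpha> t)" if "t \<in> carrier T" for t
    using that cont assms
    by (auto simp: continuous_map_in_subtopology continuous_map_from_subtopology invariant_set_def)
qed (auto simp: act_one act_mult)

end

text \<open>Arbitrary index sets are allowed because a family of tuples is treated as a single point
  indexed by a product \<open>J \<times> {..<N}\<close>.\<close>

definition power_space :: "'i set \<Rightarrow> 'a metric \<Rightarrow> ('i \<Rightarrow> 'a) topology" where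
  "power_space I X = product_topology (\<lambda>_. mtopology_of X) I"

definition power_action :: "'i set \<Rightarrow> ('t \<Rightarrow> 'a \<Rightarrow> 'a) \<Rightarrow> 't \<Rightarrow> ('i \<Rightarrow> 'a) \<Rightarrow> ('i \<Rightarrow> 'a)" where
  "power_action I \<phi> t x = (\<lambda>i\<in>I. \<phi> t (x i))"

lemma power_top_eq: "power_top n X = power_space {..<n} X"
  by (simp add: power_top_def power_space_def)

lemma diag_action_eq: "diag_action n \<phi> = power_action {..<n} \<phi>"
  by (simp add: diag_action_def power_action_def fun_eq_iff)

lemma topspace_power_space [simp]: "topspace (power_space I X) = I \<rightarrow>\<^sub>E mspace X"
  by (simp add: power_space_def)

lemma compact_power_space: "compact_space (mtopology_of X) \<Longrightarrow> compact_space (power_space I X)"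
  by (simp add: power_space_def compact_space_product_topology)

lemma Hausdorff_power_space: "Hausdorff_space (power_space I X)"
  by (simp add: power_space_def Hausdorff_space_product_topology Hausdorff_space_mtopology_of)

lemma continuous_map_power_space_coordinate:
  "i \<in> I \<Longrightarrow> continuous_map (power_space I X) (mtopology_of X) (\<lambda>x. x i)"
  unfolding power_space_def by (rule continuous_map_product_projection)

lemma closedin_coordinates_eq:
  assumes "i \<in> I" "j \<in> I"
  shows "closedin (power_space I X) {z \<in> I \<rightarrow>\<^sub>E mspace X. z i = z j}"
  using closedin_continuous_maps_eq[OF Hausdorff_space_mtopology_of
    continuous_map_power_space_coordinate[OF assms(1)] continuous_map_power_space_coordinate[OF assms(2)]]
  by simp

lemma continuous_map_into_power_space:
  "continuous_map W (power_space I X) (\<lambda>z. \<lambda>i\<in>I. f z i) \<longleftrightarrow>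
     (\<forall>i\<in>I. continuous_map W (mtopology_of X) (\<lambda>z. f z i))"
  unfolding power_space_def continuous_map_componentwise
  by (auto intro: continuous_map_eq)

lemma power_topological_action:
  assumes "topological_action T (mtopology_of X) \<phi>"
  shows "topological_action T (power_space I X) (power_action I \<phi>)"
proof -
  interpret topological_action T "mtopology_of X" \<phi> by fact
  show ?thesis
  proof unfold_locales
    fix t assume t: "t \<in> carrier T"
    have "continuous_map (power_space I X) (mtopology_of X) (\<lambda>x. \<phi> t (x i))" if "i \<in> I" for i
      using continuous_map_compose[OF continuous_map_power_space_coordinate[OF that] cont[OF t]]
      by (simp add: o_def)
    then show "continuous_map (power_space I X) (power_space I X) (power_action I \<phi> t)"
      unfolding power_action_def[abs_def] continuous_map_into_power_space by blast
  qed (auto simp: power_action_def act_one act_mult PiE_iff extensional_def fun_eq_iff)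
qed

text \<open>Selecting coordinates along \<open>g\<close> covers both tuples with repeated entries
  and the blocks of a concatenation; for \<open>g\<close> from \<open>J\<close> to \<open>I\<close>
  it is continuous and equivariant.\<close>

definition reindex :: "'j set \<Rightarrow> ('j \<Rightarrow> 'i) \<Rightarrow> ('i \<Rightarrow> 'a) \<Rightarrow> ('j \<Rightarrow> 'a)" where
  "reindex J g x = (\<lambda>j\<in>J. x (g j))"

lemma continuous_map_reindex:
  "g \<in> J \<rightarrow> I \<Longrightarrow> continuous_map (power_space I X) (power_space J X) (reindex J g)"
  unfolding reindex_def[abs_def] continuous_map_into_power_space
  by (auto intro!: continuous_map_power_space_coordinate)

lemma reindex_power_action:
  "g \<in> J \<rightarrow> I \<Longrightarrow> reindex J g (power_action I \<phi> t x) = power_action J \<phi> t (reindex J g x)"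
  by (auto simp: reindex_def power_action_def fun_eq_iff Pi_iff)

lemma minimal_set_reindex:
  assumes "compact_space (mtopology_of X)" "g \<in> J \<rightarrow> I"
    and "minimal_set T (power_space I X) (power_action I \<phi>) K"
  shows "minimal_set T (power_space J X) (power_action J \<phi>) (reindex J g ` K)"
  using assms
  by (intro minimal_set_image[OF compact_power_space Hausdorff_power_space continuous_map_reindex])
    (auto simp: reindex_power_action)

text \<open>A finite tuple with entries among the coordinates of \<open>c\<close> is a reindexing of
  \<open>c\<close>, so it lies in the image of \<open>K\<close>, which is a minimal set of the
  finite power.\<close>

lemma almost_periodic_set_coordinates:
  assumes "topological_action T (mtopology_of X) \<phi>" "compact_space (mtopology_of X)"
    and K: "minimal_set T (power_space I X) (power_action I \<phi>) K" and c: "c \<in> K"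
  shows "almost_periodic_set T X \<phi> (c ` I)"
  unfolding almost_periodic_set_def
proof (intro conjI allI ballI)
  have "c \<in> I \<rightarrow>\<^sub>E mspace X" using minimal_setD(4)[OF K] c by auto
  then show "c ` I \<subseteq> mspace X" by auto
  fix n :: nat and x assume x: "x \<in> {..<n} \<rightarrow>\<^sub>E c ` I"
  then have "\<forall>i\<in>{..<n}. \<exists>j\<in>I. x i = c j" by (auto simp: PiE_iff)
  then obtain g where g: "\<And>i. i \<in> {..<n} \<Longrightarrow> g i \<in> I \<and> x i = c (g i)" by metis
  interpret P: topological_action T "power_space {..<n} X" "power_action {..<n} \<phi>"
    using assms(1) by (rule power_topological_action)
  have "x = reindex {..<n} g c"
    using x g by (auto simp: reindex_def fun_eq_iff PiE_iff extensional_def)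
  then have "x \<in> reindex {..<n} g ` K" using c by blast
  moreover have "minimal_set T (power_space {..<n} X) (power_action {..<n} \<phi>) (reindex {..<n} g ` K)"
    using g by (intro minimal_set_reindex[OF assms(2) _ K]) auto
  ultimately show "minimal_point T (power_top n X) (diag_action n \<phi>) x"
    unfolding power_top_eq diag_action_eq by (rule P.minimal_set_minimal_point[rotated])
qed

section \<open>Extensions of flows and their fiber powers\<close>

locale flow_extension = group T for T :: "('t, 'm) monoid_scheme" (structure) +
  fixes X :: "'a metric" and \<phi> :: "'t \<Rightarrow> 'a \<Rightarrow> 'a"
    and Y :: "'b metric" and \<psi> :: "'t \<Rightarrow> 'b \<Rightarrow> 'b" and \<pi> :: "'a \<Rightarrow> 'b"
  assumes X: "flow T X \<phi>" and Y: "minimal_flow T Y \<psi>" and \<pi>: "extension T X \<phi> Y \<psi> \<pi>"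
begin

sublocale X: topological_action T "mtopology_of X" \<phi>
  by (rule flow_topological_action[OF is_group X])

sublocale Y: topological_action T "mtopology_of Y" \<psi>
  using Y by (intro flow_topological_action[OF is_group]) (simp add: minimal_flow_def)

lemma compact_X: "compact_space (mtopology_of X)"
  using X by (simp add: flow_def)

lemma \<pi>_cont: "continuous_map (mtopology_of X) (mtopology_of Y) \<pi>"
  and \<pi>_in: "x \<in> mspace X \<Longrightarrow> \<pi> x \<in> mspace Y"
  and \<pi>_surj: "\<pi> ` mspace X = mspace Y"
  and \<pi>_equiv: "\<lbrakk>t \<in> carrier T; x \<in> mspace X\<rbrakk> \<Longrightarrow> \<pi> (\<phi> t x) = \<psi> t (\<pi> x)"
  using \<pi> by (auto simp: extension_def)

lemma minimal_set_Y:
  assumes "minimal_set T (mtopology_of Y) \<psi> L"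
  shows "L = mspace Y"
proof -
  have "minimal_set T (mtopology_of Y) \<psi> (mspace Y)"
    using Y.minimal_action_topspace Y by (simp add: minimal_flow_def flow_def)
  from minimal_setD_eq[OF this, of L] show ?thesis
    using minimal_setD[OF assms] by simp
qed

text \<open>The fiber power of \<open>X\<close> over \<open>Y\<close>. It is closed and invariant,
  so orbit closures of its points stay inside it.\<close>

definition same_fiber :: "'i set \<Rightarrow> ('i \<Rightarrow> 'a) set" where
  "same_fiber I = {z \<in> I \<rightarrow>\<^sub>E mspace X. \<forall>i\<in>I. \<forall>j\<in>I. \<pi> (z i) = \<pi> (z j)}"

lemma closedin_same_fiber: "closedin (power_space I X) (same_fiber I)"
proof -
  have c: "continuous_map (power_space I X) (mtopology_of Y) (\<lambda>z. \<pi> (z i))" if "i \<in> I" for i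
    using continuous_map_compose[OF continuous_map_power_space_coordinate[OF that] \<pi>_cont]
    by (simp add: o_def)
  have "same_fiber I = (\<Inter>(i,j)\<in>I \<times> I. {z \<in> I \<rightarrow>\<^sub>E mspace X. \<pi> (z i) = \<pi> (z j)}) \<inter> (I \<rightarrow>\<^sub>E mspace X)"
    by (auto simp: same_fiber_def)
  also have "closedin (power_space I X) \<dots>"
  \<comment> \<open>\<open>closedin_Inter\<close> asks for a nonempty family, so the empty index set
    is treated apart.\<close>
  proof (cases "I = {}")
    case False
    then show ?thesis
      using closedin_topspace[of "power_space I X"]
        closedin_continuous_maps_eq[OF Hausdorff_space_mtopology_of c c]
      by (intro closedin_Int closedin_Inter) auto
  qed (use closedin_topspace[of "power_space I X"] in simp)
  finally show ?thesis .
qed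

lemma invariant_same_fiber: "invariant_set T (power_action I \<phi>) (same_fiber I)"
  unfolding invariant_set_def
proof (intro ballI)
  fix t x assume t: "t \<in> carrier T" and x: "x \<in> same_fiber I"
  have "x \<in> I \<rightarrow>\<^sub>E mspace X" using x by (simp add: same_fiber_def)
  then have im: "\<phi> t (x i) \<in> mspace X" "\<pi> (\<phi> t (x i)) = \<psi> t (\<pi> (x i))" if "i \<in> I" for i
    using that t X.act_closed[OF t] \<pi>_equiv[OF t] by auto
  show "power_action I \<phi> t x \<in> same_fiber I"
    unfolding same_fiber_def
  proof (intro CollectI conjI ballI)
    show "power_action I \<phi> t x \<in> I \<rightarrow>\<^sub>E mspace X" by (auto simp: power_action_def im)
    fix i j assume ij: "i \<in> I" "j \<in> I"
    then have "\<pi> (x i) = \<pi> (x j)" using x unfolding same_fiber_def by blast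
    then show "\<pi> (power_action I \<phi> t x i) = \<pi> (power_action I \<phi> t x j)"
      using ij by (simp add: power_action_def im)
  qed
qed

text \<open>Minimality of \<open>Y\<close> lets the fiber of the limit point be prescribed.\<close>

lemma minimal_point_over:
  assumes c: "c \<in> same_fiber I" and i: "i \<in> I" and y0: "y0 \<in> mspace Y"
  obtains K c' where "minimal_set T (power_space I X) (power_action I \<phi>) K"
    "K \<subseteq> power_space I X closure_of (orbit T (power_action I \<phi>) c)" "c' \<in> K"
    "\<And>j. j \<in> I \<Longrightarrow> c' j \<in> fiber X \<pi> y0"
proof -
  interpret P: topological_action T "power_space I X" "power_action I \<phi>"
    by (rule power_topological_action) unfold_locales
  let ?C = "power_space I X closure_of (orbit T (power_action I \<phi>) c)"
  have cP: "c \<in> topspace (power_space I X)" using c by (simp add: same_fiber_def)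
  obtain K where K: "K \<subseteq> ?C" "minimal_set T (power_space I X) (power_action I \<phi>) K"
    using P.minimal_set_exists[OF compact_power_space[OF compact_X]] P.orbit_closure[OF cP] by blast
  have KS: "K \<subseteq> same_fiber I"
    using K(1) P.orbit_closure_minimal[OF closedin_same_fiber invariant_same_fiber c] by blast
  \<comment> \<open>The coordinate \<open>i\<close> followed by \<pi> maps \<open>K\<close> onto a
    minimal set of \<open>Y\<close>, hence onto \<open>Y\<close>; so some point of \<open>K\<close>
    lies over \<open>y0\<close>.\<close>
  have "minimal_set T (mtopology_of Y) \<psi> ((\<lambda>z. \<pi> (z i)) ` K)"
  proof (rule minimal_set_image[OF compact_power_space[OF compact_X] Hausdorff_space_mtopology_of _ _ K(2)])
    show "continuous_map (power_space I X) (mtopology_of Y) (\<lambda>z. \<pi> (z i))"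
      using continuous_map_compose[OF continuous_map_power_space_coordinate[OF i] \<pi>_cont]
      by (simp add: o_def)
    show "\<pi> (power_action I \<phi> t x i) = \<psi> t (\<pi> (x i))"
      if "t \<in> carrier T" "x \<in> topspace (power_space I X)" for t x
      using that i \<pi>_equiv by (auto simp: power_action_def)
  qed
  from minimal_set_Y[OF this] y0 obtain c' where c': "c' \<in> K" "y0 = \<pi> (c' i)" by blast
  then have "c' j \<in> fiber X \<pi> y0" if "j \<in> I" for j
    using that KS i unfolding same_fiber_def fiber_def by auto
  then show ?thesis using that K c'(1) by blast
qed

end

section \<open>Factors of a minimal action realised in a metric space\<close>

locale minimal_factor = topological_action T W \<alpha>
  for T :: "('t, 'm) monoid_scheme" (structure) and W :: "'a topology" and \<alpha> +
  fixes F :: "'a \<Rightarrow> 'c::metric_space"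
  assumes compact: "compact_space W" and nonempty: "topspace W \<noteq> {}"
    and minimal: "minimal_action T W \<alpha>"
    and F_cont: "continuous_map W euclidean F"
    and F_compat: "\<lbrakk>p \<in> topspace W; q \<in> topspace W; F p = F q; t \<in> carrier T\<rbrakk> \<Longrightarrow> F (\<alpha> t p) = F (\<alpha> t q)"
begin

text \<open>The quotient of \<open>W\<close> by the fibers of \<open>F\<close> is realised as the
  image of \<open>F\<close>, which inherits a metric; \<open>F_compat\<close> says that the fibers
  of \<open>F\<close> form an invariant relation.\<close>

definition factor_metric :: "'c metric" where
  "factor_metric = submetric euclidean_metric (F ` topspace W)"

definition factor_action :: "'t \<Rightarrow> 'c \<Rightarrow> 'c" where
  "factor_action t = (\<lambda>y\<in>F ` topspace W. F (\<alpha> t (inv_into (topspace W) F y)))"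

text \<open>The map induced on the factor by a function constant on the fibers of \<open>F\<close>,
  evaluated at a chosen preimage.\<close>

definition descend :: "('a \<Rightarrow> 'd) \<Rightarrow> 'c \<Rightarrow> 'd" where
  "descend G y = G (inv_into (topspace W) F y)"

lemma mspace_factor [simp]: "mspace factor_metric = F ` topspace W"
  and mdist_factor [simp]: "mdist factor_metric = dist"
  by (simp_all add: factor_metric_def)

lemma F_cont_factor: "continuous_map W (mtopology_of factor_metric) F"
  using F_cont by (auto simp: factor_metric_def mtopology_of_submetric continuous_map_in_subtopology)

text \<open>A continuous surjection from a compact space onto a Hausdorff space is a quotient map.
  Continuity of the induced maps rests on this.\<close>

lemma quotient_F: "quotient_map W (mtopology_of factor_metric) F"
  using compact by (intro continuous_imp_quotient_map F_cont_factor Hausdorff_space_mtopology_of) auto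

lemma compact_factor: "compact_space (mtopology_of factor_metric)"
  using image_compactin[OF _ F_cont_factor, of "topspace W"] compact by (simp add: compact_space_def)

lemma descend_apply:
  assumes "\<And>p q. \<lbrakk>p \<in> topspace W; q \<in> topspace W; F p = F q\<rbrakk> \<Longrightarrow> G p = G q" "p \<in> topspace W"
  shows "descend G (F p) = G p"
  unfolding descend_def
  by (rule assms(1)) (use assms(2) in \<open>auto intro: inv_into_into f_inv_into_f\<close>)

lemma descend_continuous:
  assumes G: "continuous_map W V G"
    and "\<And>p q. \<lbrakk>p \<in> topspace W; q \<in> topspace W; F p = F q\<rbrakk> \<Longrightarrow> G p = G q"
  shows "continuous_map (mtopology_of factor_metric) V (descend G)"
proof (rule continuous_compose_quotient_map[OF quotient_F])
  show "continuous_map W V (descend G \<circ> F)"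
    by (rule continuous_map_eq[OF G]) (simp add: descend_apply[OF assms(2)])
qed

lemma factor_action_apply:
  assumes "t \<in> carrier T" "p \<in> topspace W"
  shows "factor_action t (F p) = F (\<alpha> t p)"
  using descend_apply[OF F_compat[OF _ _ _ assms(1)] assms(2)] assms(2)
  by (simp add: factor_action_def descend_def)

lemma factor_topological_action: "topological_action T (mtopology_of factor_metric) factor_action"
proof unfold_locales
  fix t assume t: "t \<in> carrier T"
  have "continuous_map W (mtopology_of factor_metric) (\<lambda>p. F (\<alpha> t p))"
    using continuous_map_compose[OF cont[OF t] F_cont_factor] by (simp add: o_def)
  then have "continuous_map (mtopology_of factor_metric) (mtopology_of factor_metric) (descend (\<lambda>p. F (\<alpha> t p)))"
    using F_compat[OF _ _ _ t] by (rule descend_continuous)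
  then show "continuous_map (mtopology_of factor_metric) (mtopology_of factor_metric) (factor_action t)"
    by (rule continuous_map_eq) (auto simp: descend_def factor_action_def)
qed (auto simp: factor_action_apply act_closed act_one act_mult)

lemma factor_minimal_flow: "minimal_flow T factor_metric factor_action"
proof -
  interpret Z: topological_action T "mtopology_of factor_metric" factor_action
    by (rule factor_topological_action)
  have "flow T factor_metric factor_action"
    using nonempty by (intro topological_actionI_flow factor_topological_action compact_factor)
      (auto simp: factor_action_def)
  moreover have "minimal_set T (mtopology_of factor_metric) factor_action (F ` topspace W)"
    by (rule minimal_set_image[OF compact Hausdorff_space_mtopology_of F_cont_factor _
          minimal_action_topspace[OF minimal nonempty]]) (simp add: factor_action_apply)
  then have "minimal_action T (mtopology_of factor_metric) factor_action"
    using Z.minimal_set_minimal_action subtopology_topspace[of "mtopology_of factor_metric"]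
    by fastforce
  ultimately show ?thesis by (simp add: minimal_flow_def)
qed

lemma descend_extension:
  assumes G: "continuous_map W (mtopology_of V) G"
    and "\<And>p q. \<lbrakk>p \<in> topspace W; q \<in> topspace W; F p = F q\<rbrakk> \<Longrightarrow> G p = G q"
    and eq: "\<And>t p. \<lbrakk>t \<in> carrier T; p \<in> topspace W\<rbrakk> \<Longrightarrow> G (\<alpha> t p) = \<beta> t (G p)"
    and surj: "G ` topspace W = mspace V"
  shows "extension T factor_metric factor_action V \<beta> (descend G)"
proof -
  have ap: "descend G (F p) = G p" if "p \<in> topspace W" for p
    using that assms(2) by (intro descend_apply)
  show ?thesis
    unfolding extension_def
  proof (intro conjI ballI)
    show "continuous_map (mtopology_of factor_metric) (mtopology_of V) (descend G)"
      using assms(1,2) by (rule descend_continuous)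
    show "descend G ` mspace factor_metric = mspace V"
      unfolding surj[symmetric] by (simp add: image_image ap)
    fix t y assume t: "t \<in> carrier T" and "y \<in> mspace factor_metric"
    then obtain p where p: "p \<in> topspace W" "y = F p" by auto
    then show "descend G (factor_action t y) = \<beta> t (descend G y)"
      by (simp add: factor_action_apply[OF t] ap act_closed[OF t] eq[OF t])
  qed
qed

end

subsection \<open>Singleton fibers\<close>

context flow_extension
begin

lemma fiber_act:
  assumes "t \<in> carrier T" "z \<in> fiber X \<pi> y"
  shows "\<phi> t z \<in> fiber X \<pi> (\<psi> t y)"
  using assms X.act_closed[OF assms(1)] \<pi>_equiv[OF assms(1)] by (auto simp: fiber_def)

lemma fiber_act_inv:
  assumes t: "t \<in> carrier T" and y: "y \<in> mspace Y" and z: "z \<in> fiber X \<pi> (\<psi> t y)"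
  shows "\<phi> (inv t) z \<in> fiber X \<pi> y"
  using fiber_act[OF inv_closed[OF t] z] Y.act_inv[OF t] y by simp

lemma fiber_nonempty: "y \<in> mspace Y \<Longrightarrow> fiber X \<pi> y \<noteq> {}"
  unfolding \<pi>_surj[symmetric] by (auto simp: fiber_def)

definition small_fibers :: "real \<Rightarrow> 'b set" where
  "small_fibers \<epsilon> = {y \<in> mspace Y. \<forall>z\<in>fiber X \<pi> y. \<forall>z'\<in>fiber X \<pi> y. mdist X z z' < \<epsilon>}"

text \<open>Upper semicontinuity of the fibers: the complement is the image in \<open>Y\<close> of
  the compact set of pairs that lie in one fiber at distance at least \<epsilon>, hence
  closed.\<close>

lemma openin_small_fibers: "openin (mtopology_of Y) (small_fibers \<epsilon>)"
proof -
  let ?P = "prod_topology (mtopology_of X) (mtopology_of X)"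
  define C where "C = {p \<in> topspace ?P. \<pi> (fst p) = \<pi> (snd p)} \<inter>
    {p \<in> topspace ?P. mdist X (fst p) (snd p) \<in> {\<epsilon>..}}"
  have c: "continuous_map ?P (mtopology_of Y) (\<lambda>p. \<pi> (fst p))"
    "continuous_map ?P (mtopology_of Y) (\<lambda>p. \<pi> (snd p))"
    using continuous_map_compose[OF continuous_map_fst \<pi>_cont]
      continuous_map_compose[OF continuous_map_snd \<pi>_cont] by (auto simp: o_def)
  have "closedin ?P C"
    unfolding C_def
  proof (rule closedin_Int)
    show "closedin ?P {p \<in> topspace ?P. \<pi> (fst p) = \<pi> (snd p)}"
      by (rule closedin_continuous_maps_eq[OF Hausdorff_space_mtopology_of c])
    have "continuous_map ?P euclideanreal (\<lambda>p. mdist X (fst p) (snd p))"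
      by (intro continuous_map_mdist continuous_map_fst continuous_map_snd)
    then show "closedin ?P {p \<in> topspace ?P. mdist X (fst p) (snd p) \<in> {\<epsilon>..}}"
      by (rule closedin_continuous_map_preimage) simp
  qed
  moreover have "compact_space ?P"
    using compact_X by (simp add: compact_space_prod_topology)
  ultimately have "compactin (mtopology_of Y) ((\<lambda>p. \<pi> (fst p)) ` C)"
    using c(1) closedin_compact_space image_compactin by metis
  then have "closedin (mtopology_of Y) ((\<lambda>p. \<pi> (fst p)) ` C)"
    using compactin_imp_closedin Hausdorff_space_mtopology_of by blast
  moreover have "mspace Y - (\<lambda>p. \<pi> (fst p)) ` C = small_fibers \<epsilon>"
  proof -
    have C_iff: "(z, z') \<in> C \<longleftrightarrow> z \<in> mspace X \<and> z' \<in> mspace X \<and> \<pi> z = \<pi> z' \<and> \<epsilon> \<le> mdist X z z'" for z z'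
      by (auto simp: C_def)
    have "(\<exists>p\<in>C. y = \<pi> (fst p)) \<longleftrightarrow>
        (\<exists>z\<in>fiber X \<pi> y. \<exists>z'\<in>fiber X \<pi> y. \<not> mdist X z z' < \<epsilon>)" for y
    proof
      assume "\<exists>p\<in>C. y = \<pi> (fst p)"
      then obtain z z' where "(z, z') \<in> C" "y = \<pi> z" by force
      then have "z \<in> fiber X \<pi> y" "z' \<in> fiber X \<pi> y" "\<not> mdist X z z' < \<epsilon>"
        by (auto simp: C_iff fiber_def)
      then show "\<exists>z\<in>fiber X \<pi> y. \<exists>z'\<in>fiber X \<pi> y. \<not> mdist X z z' < \<epsilon>" by blast
    next
      assume "\<exists>z\<in>fiber X \<pi> y. \<exists>z'\<in>fiber X \<pi> y. \<not> mdist X z z' < \<epsilon>"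
      then obtain z z' where "z \<in> fiber X \<pi> y" "z' \<in> fiber X \<pi> y" "\<not> mdist X z z' < \<epsilon>" by blast
      then have "(z, z') \<in> C" "y = \<pi> (fst (z, z'))" by (auto simp: C_iff fiber_def)
      then show "\<exists>p\<in>C. y = \<pi> (fst p)" by blast
    qed
    then show ?thesis unfolding small_fibers_def image_def by auto
  qed
  ultimately show ?thesis by (metis openin_diff openin_topspace topspace_mtopology_of)
qed

lemma small_fibers_mono: "\<delta> \<le> \<epsilon> \<Longrightarrow> small_fibers \<delta> \<subseteq> small_fibers \<epsilon>"
  by (force simp: small_fibers_def)

text \<open>The fiber over \<open>\<psi> s y\<close> is the image under \<open>\<phi> s\<close> of
  the fiber over \<open>y\<close>, and \<open>\<phi> s\<close> is uniformly continuous by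
  compactness.\<close>

lemma small_fibers_shift:
  assumes s: "s \<in> carrier T" and "\<epsilon> > 0"
  obtains \<delta> where "\<delta> > 0" "\<And>y. y \<in> small_fibers \<delta> \<Longrightarrow> \<psi> s y \<in> small_fibers \<epsilon>"
proof -
  have "uniformly_continuous_map X X (\<phi> s)"
    using compact_X X.cont[OF s] by (intro continuous_imp_uniformly_continuous_map) blast
  then obtain \<delta> where "\<delta> > 0" and
    \<delta>: "\<And>z z'. \<lbrakk>z \<in> mspace X; z' \<in> mspace X; mdist X z z' < \<delta>\<rbrakk> \<Longrightarrow> mdist X (\<phi> s z) (\<phi> s z') < \<epsilon>"
    using \<open>\<epsilon> > 0\<close> unfolding uniformly_continuous_map_def by blast
  moreover have "\<psi> s y \<in> small_fibers \<epsilon>" if y: "y \<in> small_fibers \<delta>" for y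
  proof -
    have yY: "y \<in> mspace Y" using y by (simp add: small_fibers_def)
    have "mdist X z z' < \<epsilon>" if z: "z \<in> fiber X \<pi> (\<psi> s y)" "z' \<in> fiber X \<pi> (\<psi> s y)" for z z'
    proof -
      have zX: "z \<in> mspace X" "z' \<in> mspace X" using z by (auto simp: fiber_def)
      have "\<phi> (inv s) z \<in> fiber X \<pi> y" "\<phi> (inv s) z' \<in> fiber X \<pi> y"
        using fiber_act_inv[OF s yY] z by auto
      then have "mdist X (\<phi> s (\<phi> (inv s) z)) (\<phi> s (\<phi> (inv s) z')) < \<epsilon>"
        using y by (intro \<delta>) (auto simp: small_fibers_def fiber_def)
      then show ?thesis using X.act_inv'[OF s] zX by simp
    qed
    then show ?thesis using Y.act_closed[OF s] yY by (auto simp: small_fibers_def)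
  qed
  ultimately show ?thesis using that by blast
qed

lemma singleton_fiber_iff:
  assumes "z \<in> mspace X"
  shows "fiber X \<pi> (\<pi> z) = {z} \<longleftrightarrow> (\<forall>n. \<pi> z \<in> small_fibers (inverse (Suc n)))"
proof
  assume "fiber X \<pi> (\<pi> z) = {z}"
  then show "\<forall>n. \<pi> z \<in> small_fibers (inverse (Suc n))"
    using assms \<pi>_in by (auto simp: small_fibers_def Metric_space.mdist_zero[OF Metric_space_mspace_mdist])
next
  assume R: "\<forall>n. \<pi> z \<in> small_fibers (inverse (Suc n))"
  have "z' = z" if z': "z' \<in> fiber X \<pi> (\<pi> z)" for z'
  proof (rule ccontr)
    assume "z' \<noteq> z"
    then have "mdist X z' z > 0" using z' assms
      by (auto simp: fiber_def intro: Metric_space.mdist_pos_less[OF Metric_space_mspace_mdist])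
    then obtain n where "inverse (Suc n) < mdist X z' z" using reals_Archimedean by blast
    moreover have "mdist X z' z < inverse (Suc n)"
      using R z' assms by (auto simp: small_fibers_def fiber_def)
    ultimately show False by simp
  qed
  then show "fiber X \<pi> (\<pi> z) = {z}" using assms by (auto simp: fiber_def)
qed

text \<open>The points alone in their fiber form a countable intersection of preimages of the open
  sets \<open>small_fibers\<close>. The action permutes the singleton fibers, so this set contains
  the orbit of \<open>z\<close>, which is dense by minimality.\<close>

lemma almost_one_to_oneI:
  assumes min: "minimal_action T (mtopology_of X) \<phi>"
    and z: "z \<in> mspace X" "fiber X \<pi> (\<pi> z) = {z}"
  shows "almost_one_to_one X \<pi>"
  unfolding almost_one_to_one_def
proof (intro exI conjI ballI)
  let ?X0 = "\<Inter>n. {z \<in> topspace (mtopology_of X). \<pi> z \<in> small_fibers (inverse (Suc n))}"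
  have X0: "z \<in> ?X0 \<longleftrightarrow> z \<in> mspace X \<and> fiber X \<pi> (\<pi> z) = {z}" for z
    using singleton_fiber_iff by auto
  show "fiber X \<pi> (\<pi> z) = {z}" if "z \<in> ?X0" for z
    using that X0 by blast
  show "gdelta_in (mtopology_of X) ?X0"
    by (intro gdelta_in_Inter)
      (auto intro!: open_imp_gdelta_in openin_continuous_map_preimage[OF \<pi>_cont openin_small_fibers]
        simp del: topspace_mtopology_of)
  have "orbit T \<phi> z \<subseteq> ?X0"
  proof
    fix w assume "w \<in> orbit T \<phi> z"
    then obtain t where t: "t \<in> carrier T" "w = \<phi> t z" by (auto simp: orbit_def)
    have "w \<in> mspace X" using t z X.act_closed by simp
    moreover have "v = w" if v: "v \<in> fiber X \<pi> (\<pi> w)" for v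
    proof -
      have "\<phi> (inv t) v \<in> fiber X \<pi> (\<pi> z)"
        using v t z \<pi>_equiv \<pi>_in by (intro fiber_act_inv) auto
      then have "\<phi> (inv t) v = z" using z by simp
      then show ?thesis using X.act_inv'[OF t(1), of v] v t by (simp add: fiber_def)
    qed
    ultimately show "w \<in> ?X0" unfolding X0 by (auto simp: fiber_def)
  qed
  then have "mtopology_of X closure_of orbit T \<phi> z \<subseteq> mtopology_of X closure_of ?X0"
    by (rule closure_of_mono)
  moreover have "mtopology_of X closure_of orbit T \<phi> z = mspace X"
    using min z unfolding minimal_action_def by simp
  ultimately show "mtopology_of X closure_of ?X0 = mspace X"
    using closure_of_subset_topspace[of "mtopology_of X"] by fastforce
qed

text \<open>Compactness gives a point \<open>x\<close> in the closures of all the sets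
  \<open>small_fibers (inverse (Suc n))\<close>. Minimality moves \<open>x\<close>, and a
  neighborhood of it, into a given open set, and points near \<open>x\<close> with very small fibers
  keep small fibers under this move.\<close>

lemma dense_small_fibers:
  assumes y: "y \<in> mspace Y"
    and contract: "\<And>\<epsilon>. \<epsilon> > 0 \<Longrightarrow> \<exists>t\<in>carrier T. \<psi> t y \<in> small_fibers \<epsilon>"
    and "\<epsilon> > 0"
  shows "mtopology_of Y closure_of small_fibers \<epsilon> = mspace Y"
proof -
  define E where "E n = mtopology_of Y closure_of (small_fibers (inverse (Suc n)))" for n
  have comp: "compact_space (mtopology_of Y)" using Y by (simp add: minimal_flow_def flow_def)
  have "(\<Inter>n. E n) \<noteq> {}"
  proof (rule compact_space_imp_nest[OF comp])
    show "closedin (mtopology_of Y) (E n)" for n by (simp add: E_def)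
    show "E n \<noteq> {}" for n
      using contract[of "inverse (Suc n)"] closure_of_subset[OF openin_subset[OF openin_small_fibers]]
      unfolding E_def by fastforce
    show "decseq E"
      unfolding decseq_def E_def by (intro allI impI closure_of_mono small_fibers_mono) simp
  qed
  then obtain x where x: "\<And>n. x \<in> E n" by blast
  then have xY: "x \<in> mspace Y"
    using closure_of_subset_topspace[of "mtopology_of Y"] unfolding E_def by fastforce
  have "small_fibers \<epsilon> \<inter> V \<noteq> {}" if V: "openin (mtopology_of Y) V" "V \<noteq> {}" for V
  proof -
    obtain v where v: "v \<in> V" using V by blast
    have "v \<in> mtopology_of Y closure_of (orbit T \<psi> x)"
      using v xY Y openin_subset[OF V(1)] by (auto simp: minimal_flow_def minimal_action_def)
    then obtain s where s: "s \<in> carrier T" "\<psi> s x \<in> V"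
      using Y.orbit_meets_open V v by blast
    \<comment> \<open>The group element is fixed first; only then is the fiber size near
      \<open>x\<close> chosen small enough to survive its action.\<close>
    obtain \<delta> where \<delta>: "\<delta> > 0" "\<And>y. y \<in> small_fibers \<delta> \<Longrightarrow> \<psi> s y \<in> small_fibers \<epsilon>"
      using small_fibers_shift[OF s(1) \<open>\<epsilon> > 0\<close>] by blast
    obtain n where n: "inverse (Suc n) < \<delta>" using reals_Archimedean \<delta> by blast
    define U where "U = {w \<in> topspace (mtopology_of Y). \<psi> s w \<in> V}"
    have "openin (mtopology_of Y) U"
      unfolding U_def using Y.cont[OF s(1)] V(1) by (rule openin_continuous_map_preimage)
    moreover have "x \<in> U" using s xY by (simp add: U_def)
    ultimately have "\<exists>w. w \<in> small_fibers (inverse (Suc n)) \<and> w \<in> U"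
      using x[of n] unfolding E_def in_closure_of by (elim conjE allE[of _ U] impE) auto
    then obtain w where "w \<in> small_fibers (inverse (Suc n))" "\<psi> s w \<in> V"
      unfolding U_def by blast
    then show ?thesis using \<delta>(2) small_fibers_mono[of "inverse (Suc n)" \<delta>] n by fastforce
  qed
  then show ?thesis
    using dense_intersects_open[of "mtopology_of Y" "small_fibers \<epsilon>"] by auto
qed

text \<open>Baire category theorem: the sets \<open>small_fibers (inverse (Suc n))\<close> are open
  and dense in a compact metric space, so some point lies in all of them. It may differ from the
  given \<open>y\<close>.\<close>

lemma singleton_fiber_exists:
  assumes "y \<in> mspace Y"
    and "\<And>\<epsilon>. \<epsilon> > 0 \<Longrightarrow> \<exists>t\<in>carrier T. \<psi> t y \<in> small_fibers \<epsilon>"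
  obtains z where "z \<in> mspace X" "fiber X \<pi> (\<pi> z) = {z}"
proof -
  interpret M: Metric_space "mspace Y" "mdist Y" by simp
  have top: "mtopology_of Y = M.mtopology" by (simp add: mtopology_of_def)
  have "M.mtopology closure_of (\<Inter>n. small_fibers (inverse (Suc n))) = mspace Y"
  proof (rule M.metric_Baire_category)
    show M.mcomplete
      using Y by (intro M.compact_space_imp_mcomplete) (simp add: top minimal_flow_def flow_def)
  qed (use openin_small_fibers dense_small_fibers[OF assms] in \<open>auto simp: top\<close>)
  then obtain y where y: "y \<in> (\<Inter>n. small_fibers (inverse (Suc n)))"
    using assms(1) closure_of_empty by (metis ex_in_conv)
  then have "y \<in> mspace Y" by (simp add: small_fibers_def)
  then obtain z where z: "z \<in> mspace X" "\<pi> z = y" using fiber_nonempty by (auto simp: fiber_def)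
  then show ?thesis using that singleton_fiber_iff[OF z(1)] y by blast
qed

end

subsection \<open>Tuples enumerating maximal almost periodic sets\<close>

text \<open>By total boundedness there are finite nets of mesh \<open>inverse (Suc n)\<close>; their
  union is countable, dense and nonempty, so a sequence enumerates it.\<close>

lemma dense_sequence_exists:
  assumes "compact_space (mtopology_of X)" "mspace X \<noteq> {}"
  obtains q :: "nat \<Rightarrow> 'a" where "range q \<subseteq> mspace X" "mtopology_of X closure_of (range q) = mspace X"
proof -
  interpret M: Metric_space "mspace X" "mdist X" by simp
  have top: "mtopology_of X = M.mtopology" by (simp add: mtopology_of_def)
  have "M.mtotally_bounded (mspace X)"
    using assms M.compact_space_eq_mcomplete_mtotally_bounded by (simp add: top)
  then have "\<exists>K. finite K \<and> K \<subseteq> mspace X \<and> mspace X \<subseteq> (\<Union>x\<in>K. M.mball x (inverse (Suc n)))" for n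
    unfolding M.mtotally_bounded_def by simp
  then obtain K where K: "\<And>n. finite (K n)" "\<And>n. K n \<subseteq> mspace X"
    "\<And>n. mspace X \<subseteq> (\<Union>x\<in>K n. M.mball x (inverse (Suc n)))" by metis
  define D where "D = (\<Union>n. K n)"
  have D: "countable D" "D \<subseteq> mspace X" using K by (auto simp: D_def countable_finite)
  have "D \<noteq> {}" using K(3)[of 0] assms(2) by (auto simp: D_def)
  then have range: "range (from_nat_into D) = D" using D(1) by (rule range_from_nat_into)
  have "x \<in> M.mtopology closure_of D" if x: "x \<in> mspace X" for x
    unfolding M.metric_closure_of
  proof (intro CollectI conjI x allI impI)
    fix r :: real assume "r > 0"
    then obtain n where n: "inverse (Suc n) < r" using reals_Archimedean by blast
    obtain y where y: "y \<in> K n" "x \<in> M.mball y (inverse (Suc n))" using K(3)[of n] x by blast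
    then have "y \<in> M.mball x r" using n by (simp add: M.commute)
    then show "\<exists>y\<in>D. y \<in> M.mball x r" using y by (auto simp: D_def)
  qed
  then have "mtopology_of X closure_of D = mspace X"
    using closure_of_subset_topspace[of M.mtopology D] by (auto simp: top)
  then show ?thesis using that[of "from_nat_into D"] range D by simp
qed

lemma proximal_pairI:
  assumes "\<And>\<epsilon>. \<epsilon> > 0 \<Longrightarrow> \<exists>t\<in>carrier T. mdist X (\<phi> t x) (\<phi> t x') < \<epsilon>"
  shows "proximal_pair T X \<phi> x x'"
proof -
  let ?I = "INF t\<in>carrier T. mdist X (\<phi> t x) (\<phi> t x')"
  have ne: "carrier T \<noteq> {}" using assms[of 1] by auto
  have "0 \<le> ?I" using ne by (intro cINF_greatest) auto
  moreover have "?I \<le> 0 + \<epsilon>" if \<epsilon>: "\<epsilon> > 0" for \<epsilon>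
  proof -
    obtain t where t: "t \<in> carrier T" "mdist X (\<phi> t x) (\<phi> t x') < \<epsilon>" using assms[OF \<epsilon>] by blast
    have "?I \<le> mdist X (\<phi> t x) (\<phi> t x')"
      using t(1) by (intro cINF_lower) (auto intro!: bdd_belowI2[where m = 0])
    then show ?thesis using t(2) by simp
  qed
  then have "?I \<le> 0" by (rule field_le_epsilon)
  ultimately show ?thesis by (simp add: proximal_pair_def)
qed

text \<open>\<open>N\<close> is tied to the fiber over a single base point \<open>y0\<close>;
  \<open>minimal_point_over\<close> makes this bound effective for tuples over any point of
  \<open>Y\<close>. The dense sequence \<open>q\<close> serves to encode sets of points by countably
  many real numbers.\<close>

locale maximal_almost_periodic = flow_extension T X \<phi> Y \<psi> \<pi>
  for T :: "('t, 'm) monoid_scheme" (structure) and X :: "'a metric" and \<phi>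
    and Y :: "'b metric" and \<psi> and \<pi> +
  fixes y0 :: 'b and N :: nat and M :: "(nat \<Rightarrow> 'a) set" and q :: "nat \<Rightarrow> 'a"
  assumes X_minimal: "minimal_flow T X \<phi>"
    and y0: "y0 \<in> mspace Y"
    and card_le: "\<lbrakk>A \<subseteq> fiber X \<pi> y0; almost_periodic_set T X \<phi> A\<rbrakk> \<Longrightarrow> finite A \<and> card A \<le> N"
    and N_pos: "0 < N"
    and M: "minimal_set T (power_space {..<N} X) (power_action {..<N} \<phi>) M"
    and M_same_fiber: "M \<subseteq> same_fiber {..<N}"
    and M_inj: "m \<in> M \<Longrightarrow> inj_on m {..<N}"
    and q_in: "range q \<subseteq> mspace X" and q_dense: "mtopology_of X closure_of (range q) = mspace X"

text \<open>A largest almost periodic set \<open>A\<close> in one fiber is enumerated without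
  repetition, and \<open>M\<close> is the orbit closure of this tuple.\<close>

lemma (in flow_extension) maximal_almost_periodic_exists:
  assumes X_min: "minimal_flow T X \<phi>" and ap: "almost_proximal T X \<phi> Y \<pi>"
  obtains y0 N M q where "maximal_almost_periodic T X \<phi> Y \<psi> \<pi> y0 N M q"
proof -
  have "mspace X \<noteq> {}" using X by (simp add: flow_def)
  then obtain x where x: "x \<in> mspace X" by blast
  define y0 where "y0 = \<pi> x"
  have y0: "y0 \<in> mspace Y" using x \<pi>_in by (simp add: y0_def)
  define good where "good A \<longleftrightarrow> A \<subseteq> fiber X \<pi> y0 \<and> almost_periodic_set T X \<phi> A" for A
  obtain N0 where N0: "\<And>A. good A \<Longrightarrow> finite A \<and> card A \<le> N0"
    using ap y0 unfolding almost_proximal_def good_def by blast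
  have TX: "topological_action T (mtopology_of X) \<phi>" by unfold_locales
  \<comment> \<open>The orbit closure of a one-point tuple contains a minimal point over
    \<open>y0\<close>. The resulting almost periodic singleton gives \<open>0 < N\<close>, so that a
    coordinate with index 0 exists.\<close>
  have const: "(\<lambda>i\<in>{0::nat}. x) \<in> same_fiber {0}" using x by (auto simp: same_fiber_def)
  obtain K and c :: "nat \<Rightarrow> 'a" where
    K: "minimal_set T (power_space {0} X) (power_action {0} \<phi>) K" "c \<in> K" "c 0 \<in> fiber X \<pi> y0"
    by (rule minimal_point_over[OF const _ y0, of 0]) auto
  have good0: "good {c 0}"
    using almost_periodic_set_coordinates[OF TX compact_X K(1,2)] K(3) by (auto simp: good_def)
  then obtain A where A: "good A" "\<And>B. good B \<Longrightarrow> card B \<le> card A"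
    using ex_has_greatest_nat[of good "{c 0}" card "Suc N0"] N0 le_imp_less_Suc by metis
  define N where "N = card A"
  have "finite A" using A N0 by blast
  then obtain h where h: "bij_betw h {..<N} A"
    using ex_bij_betw_nat_finite unfolding N_def atLeast0LessThan by blast
  \<comment> \<open>The restriction makes the enumeration extensional, as points of the power must
    be.\<close>
  define a where "a = (\<lambda>i\<in>{..<N}. h i)"
  have a: "a \<in> {..<N} \<rightarrow>\<^sub>E A" "inj_on a {..<N}"
    using h unfolding a_def bij_betw_def by (auto simp: inj_on_def)
  interpret P: topological_action T "power_space {..<N} X" "power_action {..<N} \<phi>"
    by (rule power_topological_action[OF TX])
  define M where "M = power_space {..<N} X closure_of (orbit T (power_action {..<N} \<phi>) a)"
  have "minimal_point T (power_space {..<N} X) (power_action {..<N} \<phi>) a"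
    using A(1) a unfolding good_def almost_periodic_set_def power_top_eq diag_action_eq by blast
  then have M: "minimal_set T (power_space {..<N} X) (power_action {..<N} \<phi>) M"
    unfolding M_def by (rule P.minimal_point_minimal_set)
  have A_fiber: "A \<subseteq> fiber X \<pi> y0" using A(1) by (simp add: good_def)
  have a_fiber: "a i \<in> mspace X" "\<pi> (a i) = y0" if "i \<in> {..<N}" for i
    using that a(1) A_fiber by (auto simp: fiber_def)
  have a_in: "a \<in> {..<N} \<rightarrow>\<^sub>E mspace X" using a_fiber a(1) by (auto simp: PiE_iff)
  have aM: "a \<in> M" unfolding M_def using P.orbit_closure(3) a_in by simp
  have "M \<subseteq> same_fiber {..<N}"
    unfolding M_def using a_in a_fiber
    by (intro P.orbit_closure_minimal closedin_same_fiber invariant_same_fiber) (auto simp: same_fiber_def)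
  \<comment> \<open>Equality of two coordinates is closed and invariant; if it held at one point of
    \<open>M\<close>, it would hold at the injective tuple \<open>a\<close> as well.\<close>
  moreover have "inj_on m {..<N}" if m: "m \<in> M" for m
  proof (rule inj_onI, rule ccontr)
    fix i j assume ij: "i \<in> {..<N}" "j \<in> {..<N}" "m i = m j" "i \<noteq> j"
    let ?D = "{z \<in> {..<N} \<rightarrow>\<^sub>E mspace X. z i = z j}"
    have "M \<subseteq> ?D"
    proof (rule minimal_set_subset[OF M])
      show "closedin (power_space {..<N} X) ?D"
        using ij by (intro closedin_coordinates_eq)
      show "invariant_set T (power_action {..<N} \<phi>) ?D"
        using ij X.act_closed by (auto simp: invariant_set_def power_action_def)
      show "M \<inter> ?D \<noteq> {}" using m ij minimal_setD(4)[OF M] by auto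
    qed
    then show False using aM a(2) ij by (auto simp: inj_on_def)
  qed
  moreover have "0 < N" using A(2)[OF good0] by (simp add: N_def)
  moreover obtain q :: "nat \<Rightarrow> 'a" where
    "range q \<subseteq> mspace X" "mtopology_of X closure_of (range q) = mspace X"
    using dense_sequence_exists[OF compact_X \<open>mspace X \<noteq> {}\<close>] by blast
  ultimately have "maximal_almost_periodic T X \<phi> Y \<psi> \<pi> y0 N M q"
    using X_min y0 M A N0
    by unfold_locales (auto simp: good_def N_def)
  then show ?thesis by (rule that)
qed

section \<open>Collapse and simultaneous contraction of tuples\<close>

context maximal_almost_periodic
begin

abbreviation "P \<equiv> power_space {..<N} X"
abbreviation "act \<equiv> power_action {..<N} \<phi>"

lemma TX: "topological_action T (mtopology_of X) \<phi>"
  by unfold_locales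

sublocale P: topological_action T P act
  by (rule power_topological_action[OF TX])

lemma M_in: "m \<in> M \<Longrightarrow> m \<in> {..<N} \<rightarrow>\<^sub>E mspace X"
  using minimal_setD(4)[OF M] by auto

lemma M_coord: "\<lbrakk>m \<in> M; i < N\<rbrakk> \<Longrightarrow> m i \<in> mspace X"
  using M_in by fastforce

lemma M_act: "\<lbrakk>m \<in> M; t \<in> carrier T\<rbrakk> \<Longrightarrow> act t m \<in> M"
  using minimal_setD(3)[OF M] by (auto simp: invariant_set_def)

lemma M_\<pi>: "\<lbrakk>m \<in> M; i < N; j < N\<rbrakk> \<Longrightarrow> \<pi> (m i) = \<pi> (m j)"
  using M_same_fiber by (auto simp: same_fiber_def)

text \<open>
  Since the diagonal orbit closure of the tuples contains a point over \<open>y0\<close> whose coordinates form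
  an almost periodic set, maximality of \<open>N\<close> forces all blocks to collapse onto one set.
\<close>

lemma collapse:
  assumes a: "\<And>j. j \<in> J \<Longrightarrow> a j \<in> M" and same: "\<And>j j'. \<lbrakk>j \<in> J; j' \<in> J\<rbrakk> \<Longrightarrow> \<pi> (a j 0) = \<pi> (a j' 0)"
    and "J \<noteq> {}"
  obtains c where
    "c \<in> power_space (J \<times> {..<N}) X closure_of
       (orbit T (power_action (J \<times> {..<N}) \<phi>) (\<lambda>(j, i)\<in>J \<times> {..<N}. a j i))"
    "\<And>j. j \<in> J \<Longrightarrow> reindex {..<N} (Pair j) c \<in> M"
    "\<And>j. j \<in> J \<Longrightarrow> reindex {..<N} (Pair j) c ` {..<N} = c ` (J \<times> {..<N})"
    "\<And>j j'. \<lbrakk>j \<in> J; j' \<in> J; a j 0 = a j' 0\<rbrakk> \<Longrightarrow> c (j, 0) = c (j', 0)"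
proof -
  define I where "I = J \<times> {..<N}"
  define c0 where "c0 = (\<lambda>(j, i)\<in>J \<times> {..<N}. a j i)"
  interpret Q: topological_action T "power_space I X" "power_action I \<phi>"
    by (rule power_topological_action[OF TX])
  let ?C = "power_space I X closure_of (orbit T (power_action I \<phi>) c0)"
  obtain j0 where j0: "j0 \<in> J" using \<open>J \<noteq> {}\<close> by blast
  have c0_in: "c0 \<in> I \<rightarrow>\<^sub>E mspace X"
    unfolding c0_def I_def using M_coord[OF a] by auto
  have c0_\<pi>: "\<pi> (c0 p) = \<pi> (a j0 0)" if "p \<in> I" for p
    using that same[OF _ j0] M_\<pi>[OF a _ N_pos] by (auto simp: c0_def I_def)
  have "c0 \<in> same_fiber I"
    unfolding same_fiber_def using c0_in c0_\<pi> by simp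
  moreover have "(j0, 0) \<in> I" using j0 N_pos by (simp add: I_def)
  ultimately obtain K c where
    K: "minimal_set T (power_space I X) (power_action I \<phi>) K" "K \<subseteq> ?C" "c \<in> K"
    and c_fiber: "\<And>p. p \<in> I \<Longrightarrow> c p \<in> fiber X \<pi> y0"
    using minimal_point_over[OF _ _ y0] by metis
  have cC: "c \<in> ?C" using K by blast
  \<comment> \<open>All coordinates of \<open>c\<close> lie over \<open>y0\<close>, where the
    cardinality bound is available.\<close>
  have "finite (c ` I) \<and> card (c ` I) \<le> N"
    using c_fiber almost_periodic_set_coordinates[OF TX compact_X K(1,3)] by (intro card_le) auto
  then have cI: "finite (c ` I)" "card (c ` I) \<le> N" by auto
  \<comment> \<open>The blocks of \<open>c0\<close> lie in \<open>M\<close>, which is closed and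
    invariant, so the blocks of every point of the orbit closure lie in \<open>M\<close>
    too.\<close>
  have blk: "reindex {..<N} (Pair j) c \<in> M" if j: "j \<in> J" for j
  proof -
    have g: "Pair j \<in> {..<N} \<rightarrow> I" using j by (simp add: I_def)
    let ?S = "{z \<in> topspace (power_space I X). reindex {..<N} (Pair j) z \<in> M}"
    have "?C \<subseteq> ?S"
    proof (rule Q.orbit_closure_minimal)
      show "closedin (power_space I X) ?S"
        using continuous_map_reindex[OF g] minimal_setD(2)[OF M] by (rule closedin_continuous_map_preimage)
      show "invariant_set T (power_action I \<phi>) ?S"
        using Q.act_closed M_act by (simp add: invariant_set_def reindex_power_action[OF g])
      have "reindex {..<N} (Pair j) c0 = a j"
        using M_in[OF a[OF j]] j by (auto simp: reindex_def c0_def PiE_iff extensional_def)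
      then show "c0 \<in> ?S" using a[OF j] c0_in by simp
    qed
    then show ?thesis using cC by blast
  qed
  \<comment> \<open>A block is injective and so has \<open>N\<close> distinct coordinates, while
    \<open>c\<close> takes at most \<open>N\<close> values altogether; each block exhausts
    them.\<close>
  moreover have "reindex {..<N} (Pair j) c ` {..<N} = c ` I" if j: "j \<in> J" for j
  proof (rule card_subset_eq[OF cI(1)])
    show sub: "reindex {..<N} (Pair j) c ` {..<N} \<subseteq> c ` I" using j by (auto simp: reindex_def I_def)
    have "card (reindex {..<N} (Pair j) c ` {..<N}) = N"
      using card_image[OF M_inj[OF blk[OF j]]] by simp
    then show "card (reindex {..<N} (Pair j) c ` {..<N}) = card (c ` I)"
      using card_mono[OF cI(1) sub] cI(2) by simp
  qed
  \<comment> \<open>Equality of two marked coordinates is closed and invariant, so it passes from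
    \<open>c0\<close> to \<open>c\<close>.\<close>
  moreover have "c (j, 0) = c (j', 0)" if j: "j \<in> J" "j' \<in> J" "a j 0 = a j' 0" for j j'
  proof -
    have jI: "(j, 0) \<in> I" "(j', 0) \<in> I" using j N_pos by (auto simp: I_def)
    let ?D = "{z \<in> I \<rightarrow>\<^sub>E mspace X. z (j, 0) = z (j', 0)}"
    have "?C \<subseteq> ?D"
    proof (rule Q.orbit_closure_minimal)
      show "closedin (power_space I X) ?D"
        using jI by (rule closedin_coordinates_eq)
      show "invariant_set T (power_action I \<phi>) ?D"
        using jI X.act_closed by (auto simp: invariant_set_def power_action_def)
      show "c0 \<in> ?D" using c0_in j N_pos by (simp add: c0_def)
    qed
    then show ?thesis using cC by blast
  qed
  ultimately show ?thesis using that[of c] cC unfolding I_def c0_def by blast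
qed

text \<open>A translate of the concatenated tuple comes close to the limit point from
  \<open>collapse\<close>, whose blocks all have the same \<open>F\<close>-value by
  \<open>eq\<close>; finiteness of \<open>J\<close> makes closeness an open condition. The
  implication inside \<open>eq\<close> lets one statement serve \<open>FY\<close>, which ignores
  marked points, and \<open>FX\<close>, which is applied to tuples with a common one.\<close>

lemma simultaneous_contraction:
  fixes F :: "(nat \<Rightarrow> 'a) \<Rightarrow> 'c::metric_space" and a :: "'j \<Rightarrow> nat \<Rightarrow> 'a"
  assumes F: "continuous_map P euclidean F"
    and a: "\<And>j. j \<in> J \<Longrightarrow> a j \<in> M" and same: "\<And>j j'. \<lbrakk>j \<in> J; j' \<in> J\<rbrakk> \<Longrightarrow> \<pi> (a j 0) = \<pi> (a j' 0)"
    and J: "J \<noteq> {}" "finite J" and "\<epsilon> > 0"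
    and eq: "\<And>m m'. \<lbrakk>m \<in> M; m' \<in> M; m ` {..<N} = m' ` {..<N};
      (\<forall>j\<in>J. \<forall>j'\<in>J. a j 0 = a j' 0) \<longrightarrow> m 0 = m' 0\<rbrakk> \<Longrightarrow> F m = F m'"
  shows "\<exists>t\<in>carrier T. \<forall>j\<in>J. \<forall>j'\<in>J. dist (F (act t (a j))) (F (act t (a j'))) < \<epsilon>"
proof -
  define I where "I = J \<times> {..<N}"
  define c0 where "c0 = (\<lambda>(j, i)\<in>J \<times> {..<N}. a j i)"
  interpret Q: topological_action T "power_space I X" "power_action I \<phi>"
    by (rule power_topological_action[OF TX])
  obtain c where c: "c \<in> power_space I X closure_of (orbit T (power_action I \<phi>) c0)"
    and cM: "\<And>j. j \<in> J \<Longrightarrow> reindex {..<N} (Pair j) c \<in> M"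
    and cset: "\<And>j. j \<in> J \<Longrightarrow> reindex {..<N} (Pair j) c ` {..<N} = c ` I"
    and c0eq: "\<And>j j'. \<lbrakk>j \<in> J; j' \<in> J; a j 0 = a j' 0\<rbrakk> \<Longrightarrow> c (j, 0) = c (j', 0)"
    by (rule collapse[of J a, OF a same J(1), folded I_def c0_def]) (assumption | rule that)+
  have Feq: "F (reindex {..<N} (Pair j) c) = F (reindex {..<N} (Pair j') c)" if "j \<in> J" "j' \<in> J" for j j'
  proof (rule eq[OF cM[OF that(1)] cM[OF that(2)]])
    show "reindex {..<N} (Pair j) c ` {..<N} = reindex {..<N} (Pair j') c ` {..<N}"
      using cset[OF that(1)] cset[OF that(2)] by (rule trans[OF _ sym])
    show "(\<forall>j\<in>J. \<forall>j'\<in>J. a j 0 = a j' 0) \<longrightarrow>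
        reindex {..<N} (Pair j) c 0 = reindex {..<N} (Pair j') c 0"
    proof
      assume "\<forall>j\<in>J. \<forall>j'\<in>J. a j 0 = a j' 0"
      then have "a j 0 = a j' 0" using that by (elim ballE) blast+
      from c0eq[OF that this]
      show "reindex {..<N} (Pair j) c 0 = reindex {..<N} (Pair j') c 0"
        using N_pos by (simp add: reindex_def)
    qed
  qed
  have g: "Pair j \<in> {..<N} \<rightarrow> I" if "j \<in> J" for j using that by (simp add: I_def)
  define D where "D j j' z = dist (F (reindex {..<N} (Pair j) z)) (F (reindex {..<N} (Pair j') z))" for j j' :: 'j and z
  define U where "U = (\<Inter>p\<in>J \<times> J. {z \<in> topspace (power_space I X). D (fst p) (snd p) z \<in> {..<\<epsilon>}})"
  have D_cont: "continuous_map (power_space I X) euclideanreal (D j j')" if "j \<in> J" "j' \<in> J" for j j'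
  proof -
    have "continuous_map (power_space I X) (mtopology_of euclidean_metric) (\<lambda>z. F (reindex {..<N} (Pair j) z))"
      if "j \<in> J" for j
      using continuous_map_compose[OF continuous_map_reindex[OF g[OF that]] F] by (simp add: o_def)
    from continuous_map_mdist[OF this[OF that(1)] this[OF that(2)]] show ?thesis
      by (simp add: D_def[abs_def])
  qed
  have "openin (power_space I X) U"
    unfolding U_def using J
    by (intro openin_INT2 openin_continuous_map_preimage[OF D_cont]) auto
  moreover have "c \<in> U"
  proof -
    have "c \<in> topspace (power_space I X)" using c by (simp add: in_closure_of)
    moreover have "D j j' c = 0" if "j \<in> J" "j' \<in> J" for j j' using Feq[OF that] by (simp add: D_def)
    ultimately show ?thesis using \<open>\<epsilon> > 0\<close> unfolding U_def by auto
  qed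
  ultimately obtain t where t: "t \<in> carrier T" "power_action I \<phi> t c0 \<in> U"
    using Q.orbit_meets_open[OF c] by blast
  have "reindex {..<N} (Pair j) (power_action I \<phi> t c0) = act t (a j)" if j: "j \<in> J" for j
  proof -
    have "reindex {..<N} (Pair j) c0 = a j"
      using M_in[OF a[OF j]] j by (auto simp: reindex_def c0_def PiE_iff extensional_def)
    then show ?thesis by (simp add: reindex_power_action[OF g[OF j]])
  qed
  then show ?thesis using t unfolding U_def D_def by force
qed

text \<open>
  \<open>FY m\<close> encodes the unordered set of coordinates of \<open>m\<close>: the product of the distances to its points
  is symmetric, and its zero set, determined by the values on the dense sequence \<open>q\<close>, recovers the set.
  \<open>FX m\<close> encodes in addition the marked point \<open>m 0\<close>.
\<close>

definition FY :: "(nat \<Rightarrow> 'a) \<Rightarrow> nat \<Rightarrow> real" where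
  "FY m k = (\<Prod>i<N. mdist X (q k) (m i))"

definition FX :: "(nat \<Rightarrow> 'a) \<Rightarrow> nat \<Rightarrow> real" where
  "FX m k = (if even k then mdist X (q (k div 2)) (m 0) else FY m (k div 2))"

lemma dist_coord_cont:
  "\<lbrakk>x \<in> mspace X; i < N\<rbrakk> \<Longrightarrow> continuous_map P euclideanreal (\<lambda>m. mdist X x (m i))"
  by (intro continuous_map_mdist continuous_map_power_space_coordinate) auto

lemma q_mspace: "q k \<in> mspace X" using q_in by blast

lemma FY_coord_cont: "continuous_map P euclideanreal (\<lambda>m. FY m k)"
  unfolding FY_def by (intro continuous_map_prod dist_coord_cont q_mspace) auto

lemma FY_cont: "continuous_map P euclidean FY"
  \<comment> \<open>The type \<open>nat \<Rightarrow> real\<close> carries the product topology, so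
    continuity is checked entry by entry.\<close>
  unfolding euclidean_product_topology[symmetric] continuous_map_componentwise_UNIV
  using FY_coord_cont by blast

lemma FX_cont: "continuous_map P euclidean FX"
  unfolding euclidean_product_topology[symmetric] continuous_map_componentwise_UNIV
proof
  fix k show "continuous_map P euclideanreal (\<lambda>m. FX m k)"
    using FY_coord_cont dist_coord_cont[OF q_mspace N_pos] by (cases "even k") (simp_all add: FX_def)
qed

text \<open>Both products are continuous in the base point, so they agree on \<open>X\<close> once
  they agree on the dense range of \<open>q\<close>; their zero sets are \<open>A\<close> and
  \<open>B\<close>.\<close>

lemma dist_prod_eq:
  assumes fin: "finite A" "finite B" and AB: "A \<subseteq> mspace X" "B \<subseteq> mspace X"
    and eq: "\<And>k. (\<Prod>a\<in>A. mdist X (q k) a) = (\<Prod>b\<in>B. mdist X (q k) b)"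
  shows "A = B"
proof -
  have c: "continuous_map (mtopology_of X) euclideanreal (\<lambda>x. \<Prod>a\<in>C. mdist X x a)"
    if "finite C" "C \<subseteq> mspace X" for C
    using that by (intro continuous_map_prod continuous_map_mdist) auto
  have "(\<Prod>a\<in>A. mdist X x a) = (\<Prod>b\<in>B. mdist X x b)" if "x \<in> mspace X" for x
    by (rule forall_in_closure_of_eq[of x "mtopology_of X" "range q" euclideanreal])
      (use that q_dense c fin AB eq in auto)
  moreover have "(\<Prod>a\<in>C. mdist X x a) = 0 \<longleftrightarrow> x \<in> C" if "finite C" "C \<subseteq> mspace X" "x \<in> mspace X" for C x
    using that Metric_space.zero[OF Metric_space_mspace_mdist] by (fastforce simp: prod_zero_iff)
  ultimately show ?thesis using fin AB by (metis subset_antisym subset_iff)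
qed

text \<open>Injectivity of the tuples in \<open>M\<close> turns the product over indices into a
  product over the set of coordinates, to which \<open>dist_prod_eq\<close> applies.\<close>

lemma FY_eq_iff:
  assumes "m \<in> M" "m' \<in> M"
  shows "FY m = FY m' \<longleftrightarrow> m ` {..<N} = m' ` {..<N}"
proof -
  have FY: "FY m k = (\<Prod>a\<in>m ` {..<N}. mdist X (q k) a)" if "m \<in> M" for m k
    using prod.reindex[OF M_inj[OF that], of "mdist X (q k)"] by (simp add: FY_def)
  show ?thesis
  proof
    assume eq: "FY m = FY m'"
    show "m ` {..<N} = m' ` {..<N}"
      by (rule dist_prod_eq) (use assms M_coord FY fun_cong[OF eq] in auto)
  qed (simp add: fun_eq_iff FY[OF assms(1)] FY[OF assms(2)])
qed

lemma FX_eq_iff: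
  assumes "m \<in> M" "m' \<in> M"
  shows "FX m = FX m' \<longleftrightarrow> m 0 = m' 0 \<and> FY m = FY m'"
proof
  assume eq: "FX m = FX m'"
  \<comment> \<open>The even entries are distances to one point, that is, products over a
    singleton.\<close>
  have "{m 0} = {m' 0}"
    by (rule dist_prod_eq) (use assms M_coord N_pos fun_cong[OF eq, of "2 * k" for k] in \<open>auto simp: FX_def\<close>)
  moreover have "FY m k = FY m' k" for k using fun_cong[OF eq, of "2 * k + 1"] by (simp add: FX_def)
  ultimately show "m 0 = m' 0 \<and> FY m = FY m'" by auto
qed (auto simp: FX_def fun_eq_iff)

lemma act_image: "m \<in> M \<Longrightarrow> act t m ` {..<N} = \<phi> t ` (m ` {..<N})"
  by (auto simp: power_action_def image_iff)

lemma FY_compat: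
  assumes "m \<in> M" "m' \<in> M" "FY m = FY m'" "t \<in> carrier T"
  shows "FY (act t m) = FY (act t m')"
  using assms by (simp add: FY_eq_iff M_act act_image)

lemma FX_compat:
  assumes "m \<in> M" "m' \<in> M" "FX m = FX m'" "t \<in> carrier T"
  shows "FX (act t m) = FX (act t m')"
proof -
  have eq: "m 0 = m' 0" "FY m = FY m'" using assms FX_eq_iff by auto
  then have "FY (act t m) = FY (act t m')" using assms FY_compat by blast
  moreover have "act t m 0 = act t m' 0" using eq N_pos by (simp add: power_action_def)
  ultimately show ?thesis using assms by (simp add: FX_eq_iff M_act)
qed

section \<open>The two factors of the minimal set \<open>M\<close>\<close>

abbreviation "W \<equiv> subtopology P M"

lemma topspace_W: "topspace W = M"
  using minimal_setD(4)[OF M] by auto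

lemma compact_W: "compact_space W"
  using closedin_compact_space[OF compact_power_space[OF compact_X] minimal_setD(2)[OF M]]
  by (rule compact_space_subtopology)

lemma W_action: "topological_action T W act"
  by (rule P.subtopology_action[OF minimal_setD(3)[OF M]])

lemma minimal_factor_W:
  assumes "continuous_map P euclidean F"
    and "\<And>m m' t. \<lbrakk>m \<in> M; m' \<in> M; F m = F m'; t \<in> carrier T\<rbrakk> \<Longrightarrow> F (act t m) = F (act t m')"
  shows "minimal_factor T W act F"
proof -
  interpret W: topological_action T W act by (rule W_action)
  show ?thesis
    by unfold_locales
      (use compact_W minimal_setD(1)[OF M] P.minimal_set_minimal_action[OF M]
        continuous_map_from_subtopology[OF assms(1)] assms(2) topspace_W in \<open>auto\<close>)
qed

sublocale FX: minimal_factor T W act FX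
  by (rule minimal_factor_W[OF FX_cont FX_compat])

sublocale FY: minimal_factor T W act FY
  by (rule minimal_factor_W[OF FY_cont FY_compat])

end

subsection \<open>The extensions\<close>

context maximal_almost_periodic
begin

abbreviation "X' \<equiv> FX.factor_metric"
abbreviation "\<phi>' \<equiv> FX.factor_action"
abbreviation "Y' \<equiv> FY.factor_metric"
abbreviation "\<psi>' \<equiv> FY.factor_action"

text \<open>On tuples, \<open>\<sigma>'\<close> reads off the marked point, \<open>\<tau>'\<close>
  the point of \<open>Y\<close> below the tuple, and \<open>\<pi>'\<close> forgets which coordinate
  is marked.\<close>

definition "\<sigma>' = FX.descend (\<lambda>m. m 0)"
definition "\<tau>' = FY.descend (\<lambda>m. \<pi> (m 0))"
definition "\<pi>' = FX.descend FY"

lemma mspace_X': "mspace X' = FX ` M" and mspace_Y': "mspace Y' = FY ` M"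
  by (simp_all only: FX.mspace_factor FY.mspace_factor topspace_W)

lemma FY_eq_imp:
  assumes "m \<in> M" "m' \<in> M" "FY m = FY m'"
  obtains j where "j < N" "m' 0 = m j"
proof -
  have "m' 0 \<in> m ` {..<N}" using assms N_pos by (simp add: FY_eq_iff)
  then show ?thesis using that by auto
qed

lemma FY_eq_imp_\<pi>: "\<lbrakk>m \<in> M; m' \<in> M; FY m = FY m'\<rbrakk> \<Longrightarrow> \<pi> (m 0) = \<pi> (m' 0)"
  using FY_eq_imp[of m m'] M_\<pi>[of m 0] N_pos by metis

lemma \<sigma>'_apply:
  assumes "m \<in> M" shows "\<sigma>' (FX m) = m 0"
  unfolding \<sigma>'_def
  by (rule FX.descend_apply[unfolded topspace_W, OF _ assms]) (use FX_eq_iff in blast)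

lemma \<tau>'_apply:
  assumes "m \<in> M" shows "\<tau>' (FY m) = \<pi> (m 0)"
  unfolding \<tau>'_def
  by (rule FY.descend_apply[unfolded topspace_W, OF _ assms]) (rule FY_eq_imp_\<pi>)

lemma \<pi>'_apply:
  assumes "m \<in> M" shows "\<pi>' (FX m) = FY m"
  unfolding \<pi>'_def
  by (rule FX.descend_apply[unfolded topspace_W, OF _ assms]) (use FX_eq_iff in blast)

lemma \<phi>'_apply: "\<lbrakk>t \<in> carrier T; m \<in> M\<rbrakk> \<Longrightarrow> \<phi>' t (FX m) = FX (act t m)"
  and \<psi>'_apply: "\<lbrakk>t \<in> carrier T; m \<in> M\<rbrakk> \<Longrightarrow> \<psi>' t (FY m) = FY (act t m)"
  by (simp_all only: FX.factor_action_apply FY.factor_action_apply topspace_W)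

lemma coord0_cont: "continuous_map W (mtopology_of X) (\<lambda>m. m 0)"
  using N_pos by (intro continuous_map_from_subtopology continuous_map_power_space_coordinate) simp

text \<open>The coordinate map carries \<open>M\<close> to a minimal set of the minimal flow
  \<open>X\<close>, hence onto \<open>X\<close>.\<close>

lemma coord0_surj: "(\<lambda>m. m 0) ` M = mspace X"
proof -
  have "minimal_set T (mtopology_of X) \<phi> ((\<lambda>m. m 0) ` M)"
    by (rule minimal_set_image[OF compact_power_space[OF compact_X] Hausdorff_space_mtopology_of
          continuous_map_power_space_coordinate _ M])
      (use N_pos in \<open>auto simp: power_action_def\<close>)
  moreover have "minimal_set T (mtopology_of X) \<phi> (mspace X)"
    using X.minimal_action_topspace X_minimal by (simp add: minimal_flow_def flow_def)
  ultimately show ?thesis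
    using minimal_setD_eq[of T "mtopology_of X" \<phi> "mspace X" "(\<lambda>m. m 0) ` M"]
      minimal_setD[of T "mtopology_of X" \<phi> "(\<lambda>m. m 0) ` M"] by simp
qed

lemma \<sigma>'_extension: "extension T X' \<phi>' X \<phi> \<sigma>'"
  unfolding \<sigma>'_def
proof (rule FX.descend_extension[OF coord0_cont]; (simp only: topspace_W)?)
  show "p 0 = q 0" if "p \<in> M" "q \<in> M" "FX p = FX q" for p q using that FX_eq_iff by blast
  show "act t p 0 = \<phi> t (p 0)" for t p using N_pos by (simp add: power_action_def)
qed (rule coord0_surj)

lemma \<tau>'_extension: "extension T Y' \<psi>' Y \<psi> \<tau>'"
  unfolding \<tau>'_def
proof (rule FY.descend_extension; (simp only: topspace_W)?)
  show "continuous_map W (mtopology_of Y) (\<lambda>m. \<pi> (m 0))"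
    using continuous_map_compose[OF coord0_cont \<pi>_cont] by (simp add: o_def)
  show "\<pi> (p 0) = \<pi> (q 0)" if "p \<in> M" "q \<in> M" "FY p = FY q" for p q using that by (rule FY_eq_imp_\<pi>)
  show "\<pi> (act t p 0) = \<psi> t (\<pi> (p 0))" if "t \<in> carrier T" "p \<in> M" for t p
    using that N_pos M_coord \<pi>_equiv by (simp add: power_action_def)
  show "(\<lambda>m. \<pi> (m 0)) ` M = mspace Y"
    unfolding \<pi>_surj[symmetric] coord0_surj[symmetric] by (simp add: image_image)
qed

lemma \<pi>'_extension: "extension T X' \<phi>' Y' \<psi>' \<pi>'"
  unfolding \<pi>'_def
proof (rule FX.descend_extension[OF FY.F_cont_factor]; (simp only: topspace_W FY.mspace_factor)?)
  show "FY p = FY q" if "p \<in> M" "q \<in> M" "FX p = FX q" for p q using that FX_eq_iff by blast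
  show "FY (act t p) = \<psi>' t (FY p)" if "t \<in> carrier T" "p \<in> M" for t p
    using that by (simp only: \<psi>'_apply)
qed

lemma commutes: "x \<in> mspace X' \<Longrightarrow> \<pi> (\<sigma>' x) = \<tau>' (\<pi>' x)"
  unfolding mspace_X' by (auto simp: \<sigma>'_apply \<tau>'_apply \<pi>'_apply)

text \<open>The marked point and the unordered set together determine the code \<open>FX\<close>, so
  \<open>X'\<close> embeds in the fiber product of \<open>X\<close> and \<open>Y'\<close> over
  \<open>Y\<close>.\<close>

lemma \<sigma>'_\<pi>'_inj:
  assumes "x \<in> mspace X'" "x' \<in> mspace X'" "\<sigma>' x = \<sigma>' x'" "\<pi>' x = \<pi>' x'"
  shows "x = x'"
  using assms unfolding mspace_X' by (auto simp: \<sigma>'_apply \<pi>'_apply FX_eq_iff)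

lemma \<sigma>'_proximal: "proximal_map T X' \<phi>' \<sigma>'"
  unfolding proximal_map_def
proof (intro ballI impI)
  fix x x' assume x: "x \<in> mspace X'" and x': "x' \<in> mspace X'" and eq: "\<sigma>' x = \<sigma>' x'"
  obtain p p' where p: "p \<in> M" "x = FX p" "p' \<in> M" "x' = FX p'"
    using x x' unfolding mspace_X' by blast
  have eq0: "p 0 = p' 0" using eq p by (simp add: \<sigma>'_apply)
  \<comment> \<open>The two tuples share their marked point and form a family indexed by the finite
    type \<open>bool\<close>.\<close>
  define a where "a b = (if b then p else p')" for b
  have a: "a b \<in> M" "a b 0 = p 0" for b using p eq0 by (simp_all add: a_def)
  show "proximal_pair T X' \<phi>' x x'"
  proof (rule proximal_pairI)
    fix \<epsilon> :: real assume "\<epsilon> > 0"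
    have "\<exists>t\<in>carrier T. \<forall>b\<in>UNIV. \<forall>b'\<in>UNIV. dist (FX (act t (a b))) (FX (act t (a b'))) < \<epsilon>"
      by (rule simultaneous_contraction[OF FX_cont])
        (use a \<open>\<epsilon> > 0\<close> in \<open>auto simp: FX_eq_iff FY_eq_iff\<close>)
    then obtain t where t: "t \<in> carrier T" "dist (FX (act t (a True))) (FX (act t (a False))) < \<epsilon>" by blast
    then show "\<exists>t\<in>carrier T. mdist X' (\<phi>' t x) (\<phi>' t x') < \<epsilon>"
      using p by (auto simp: a_def \<phi>'_apply intro!: bexI[of _ t])
  qed
qed

text \<open>The finitely many points of \<open>J\<close> are represented by tuples in
  \<open>M\<close>, all over the same \<open>y\<close>, as simultaneous contraction
  requires.\<close>

lemma \<tau>'_contraction: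
  assumes J: "J \<subseteq> fiber Y' \<tau>' y" "finite J" "J \<noteq> {}" and "\<epsilon> > 0"
  shows "\<exists>t\<in>carrier T. \<forall>z\<in>J. \<forall>z'\<in>J. dist (\<psi>' t z) (\<psi>' t z') < \<epsilon>"
proof -
  define a where "a = inv_into M FY"
  have "J \<subseteq> FY ` M" using J(1) unfolding fiber_def mspace_Y' by blast
  then have a: "a z \<in> M" "FY (a z) = z" if "z \<in> J" for z
    using inv_into_into[of z FY M] f_inv_into_f[of z FY M] that unfolding a_def by (metis subsetD)+
  have "\<pi> (a z 0) = y" if "z \<in> J" for z
    using a[OF that] J(1) that \<tau>'_apply[of "a z"] by (auto simp: fiber_def)
  then have "\<exists>t\<in>carrier T. \<forall>z\<in>J. \<forall>z'\<in>J. dist (FY (act t (a z))) (FY (act t (a z'))) < \<epsilon>"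
    by (intro simultaneous_contraction[OF FY_cont]) (use a J \<open>\<epsilon> > 0\<close> in \<open>auto simp: FY_eq_iff\<close>)
  moreover have "\<psi>' t z = FY (act t (a z))" if "t \<in> carrier T" "z \<in> J" for t z
    using \<psi>'_apply[OF that(1) a(1)[OF that(2)]] a(2)[OF that(2)] by simp
  ultimately show ?thesis by simp
qed

lemma \<tau>'_proximal: "proximal_map T Y' \<psi>' \<tau>'"
  unfolding proximal_map_def
proof (intro ballI impI)
  fix z z' assume z: "z \<in> mspace Y'" "z' \<in> mspace Y'" "\<tau>' z = \<tau>' z'"
  show "proximal_pair T Y' \<psi>' z z'"
  proof (rule proximal_pairI)
    fix \<epsilon> :: real assume "\<epsilon> > 0"
    then show "\<exists>t\<in>carrier T. mdist Y' (\<psi>' t z) (\<psi>' t z') < \<epsilon>"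
      using \<tau>'_contraction[of "{z, z'}" "\<tau>' z" \<epsilon>] z unfolding fiber_def by auto
  qed
qed

text \<open>A point over \<open>FY p\<close> amounts to a choice of marked point among the
  coordinates of \<open>p\<close>, so \<open>\<sigma>'\<close> embeds the fiber in a finite
  set.\<close>

lemma \<pi>'_finite_to_one: "finite_to_one X' Y' \<pi>'"
  unfolding finite_to_one_def
proof
  fix y assume "y \<in> mspace Y'"
  then obtain p where p: "p \<in> M" "y = FY p" unfolding mspace_Y' by blast
  have "inj_on \<sigma>' (fiber X' \<pi>' y)"
    by (rule inj_onI, rule \<sigma>'_\<pi>'_inj) (simp_all add: fiber_def)
  moreover have "\<sigma>' ` fiber X' \<pi>' y \<subseteq> p ` {..<N}"
  proof
    fix v assume "v \<in> \<sigma>' ` fiber X' \<pi>' y"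
    then obtain m where m: "m \<in> M" "v = \<sigma>' (FX m)" "\<pi>' (FX m) = y"
      unfolding fiber_def mspace_X' by blast
    then have "FY p = FY m" "v = m 0" using p by (simp_all add: \<pi>'_apply \<sigma>'_apply)
    then show "v \<in> p ` {..<N}" using FY_eq_imp[OF p(1) m(1)] by blast
  qed
  ultimately show "finite (fiber X' \<pi>' y)" by (rule inj_on_finite) simp
qed

text \<open>For each nonzero index \<open>j\<close> the distance between coordinates 0 and
  \<open>j\<close> is continuous and nonzero on the compact set \<open>M\<close>. The values form
  the closed set \<open>S\<close>, which avoids 0; it is empty when \<open>N = 1\<close>.\<close>

lemma uniformly_separated:
  obtains \<delta> where "\<delta> > 0" "\<And>m j. \<lbrakk>m \<in> M; j < N; mdist X (m 0) (m j) < \<delta>\<rbrakk> \<Longrightarrow> m j = m 0"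
proof -
  define S where "S = (\<Union>j\<in>{0<..<N}. (\<lambda>m. mdist X (m 0) (m j)) ` M)"
  have "compact ((\<lambda>m. mdist X (m 0) (m j)) ` M)" if "j < N" for j
  proof -
    have "continuous_map P euclideanreal (\<lambda>m. mdist X (m 0) (m j))"
      using that N_pos by (intro continuous_map_mdist continuous_map_power_space_coordinate) auto
    from image_compactin[OF _ this] have "compactin euclideanreal ((\<lambda>m. mdist X (m 0) (m j)) ` M)"
      using closedin_compact_space[OF compact_power_space[OF compact_X] minimal_setD(2)[OF M]] .
    then show ?thesis by simp
  qed
  then have "closed S" unfolding S_def by (intro closed_UN compact_imp_closed) auto
  moreover have "0 \<notin> S"
  proof
    assume "0 \<in> S"
    then obtain j m where m: "0 < j" "j < N" "m \<in> M" "mdist X (m 0) (m j) = 0" unfolding S_def by auto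
    then have "m 0 = m j"
      using Metric_space.zero[OF Metric_space_mspace_mdist] M_coord N_pos by metis
    then show False using M_inj[OF m(3)] m N_pos by (auto simp: inj_on_def)
  qed
  ultimately obtain \<delta> where \<delta>: "\<delta> > 0" "ball 0 \<delta> \<subseteq> - S"
    using open_contains_ball[of "- S"] by (auto simp: open_Compl)
  have "m j = m 0" if "m \<in> M" "j < N" "mdist X (m 0) (m j) < \<delta>" for m j
  proof (rule ccontr)
    assume "m j \<noteq> m 0"
    then have "j \<noteq> 0" by metis
    then have "mdist X (m 0) (m j) \<in> S" using that by (auto simp: S_def)
    moreover have "mdist X (m 0) (m j) \<in> ball 0 \<delta>" using that by simp
    ultimately show False using \<delta> by blast
  qed
  then show ?thesis using that \<delta> by blast
qed

text \<open>Points of one fiber that are close enough coincide: their marked points belong to one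
  coordinate set and are close by uniform continuity of \<open>\<sigma>'\<close>, hence equal by
  uniform separation.\<close>

lemma \<pi>'_equicontinuous: "equicontinuous_map T X' \<phi>' \<pi>'"
  unfolding equicontinuous_map_def
proof (intro allI impI)
  fix \<epsilon> :: real assume "\<epsilon> > 0"
  obtain \<delta>0 where \<delta>0: "\<delta>0 > 0" "\<And>m j. \<lbrakk>m \<in> M; j < N; mdist X (m 0) (m j) < \<delta>0\<rbrakk> \<Longrightarrow> m j = m 0"
    using uniformly_separated by blast
  have "continuous_map (mtopology_of X') (mtopology_of X) \<sigma>'"
    using \<sigma>'_extension by (simp add: extension_def)
  then have "uniformly_continuous_map X' X \<sigma>'"
    using FX.compact_factor by (intro continuous_imp_uniformly_continuous_map) blast
  then obtain \<delta> where "\<delta> > 0" and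
    \<delta>: "\<And>x x'. \<lbrakk>x \<in> mspace X'; x' \<in> mspace X'; mdist X' x x' < \<delta>\<rbrakk> \<Longrightarrow> mdist X (\<sigma>' x) (\<sigma>' x') < \<delta>0"
    using \<delta>0(1) unfolding uniformly_continuous_map_def by blast
  have "mdist X' (\<phi>' t x) (\<phi>' t x') < \<epsilon>"
    if x: "x \<in> mspace X'" "x' \<in> mspace X'" "\<pi>' x = \<pi>' x'" "mdist X' x x' < \<delta>" for t x x'
  proof -
    obtain p p' where p: "p \<in> M" "x = FX p" "p' \<in> M" "x' = FX p'"
      using x(1,2) unfolding mspace_X' by blast
    have FYp: "FY p = FY p'" using x(3) p by (simp add: \<pi>'_apply)
    obtain j where j: "j < N" "p' 0 = p j" using FY_eq_imp[OF p(1,3) FYp] by blast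
    have "mdist X (p 0) (p j) < \<delta>0" using \<delta>[OF x(1,2,4)] p j by (simp add: \<sigma>'_apply)
    from \<delta>0(2)[OF p(1) j(1) this] have "p 0 = p' 0" using j(2) by simp
    then have "x = x'" using p FYp FX_eq_iff by blast
    then show ?thesis using \<open>\<epsilon> > 0\<close> by simp
  qed
  then show "\<exists>\<delta>>0. \<forall>x1\<in>mspace X'. \<forall>x2\<in>mspace X'. \<pi>' x1 = \<pi>' x2 \<and> mdist X' x1 x2 < \<delta> \<longrightarrow>
      (\<forall>t\<in>carrier T. mdist X' (\<phi>' t x1) (\<phi>' t x2) < \<epsilon>)"
    using \<open>\<delta> > 0\<close> by blast
qed

section \<open>Finite fibers of \<pi> and singleton fibers of \<open>\<tau>'\<close> and
  \<open>\<sigma>'\<close>\<close>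

lemma \<tau>'_flow_extension: "flow_extension T Y' \<psi>' Y \<psi> \<tau>'"
  using FY.factor_minimal_flow Y \<tau>'_extension
  by unfold_locales (auto simp: minimal_flow_def)

lemma \<sigma>'_flow_extension: "flow_extension T X' \<phi>' X \<phi> \<sigma>'"
  using FX.factor_minimal_flow X_minimal \<sigma>'_extension
  by unfold_locales (auto simp: minimal_flow_def)

text \<open>Over a point with finite \<pi>-fiber only finitely many coordinate sets occur, so the
  whole fiber of \<open>\<tau>'\<close> is finite and can be contracted at once; then
  \<open>singleton_fiber_exists\<close> applies.\<close>

lemma \<tau>'_singleton_fiber:
  assumes "almost_finite_to_one X Y \<pi>"
  obtains z where "z \<in> mspace Y'" "fiber Y' \<tau>' (\<tau>' z) = {z}"
proof -
  interpret \<tau>: flow_extension T Y' \<psi>' Y \<psi> \<tau>' by (rule \<tau>'_flow_extension)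
  obtain y where y: "y \<in> mspace Y" "finite (fiber X \<pi> y)"
    using assms unfolding almost_finite_to_one_def by blast
  have "fiber Y' \<tau>' y \<subseteq> FY ` ({..<N} \<rightarrow>\<^sub>E fiber X \<pi> y)"
  proof
    fix z assume "z \<in> fiber Y' \<tau>' y"
    then obtain m where m: "m \<in> M" "z = FY m" "\<pi> (m 0) = y"
      unfolding fiber_def mspace_Y' by (auto simp: \<tau>'_apply)
    have "m \<in> {..<N} \<rightarrow>\<^sub>E fiber X \<pi> y"
      using M_in[OF m(1)] M_\<pi>[OF m(1) _ N_pos] m(3) by (auto simp: fiber_def PiE_iff)
    then show "z \<in> FY ` ({..<N} \<rightarrow>\<^sub>E fiber X \<pi> y)" using m by blast
  qed
  then have J: "finite (fiber Y' \<tau>' y)"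
    using finite_PiE[of "{..<N}" "\<lambda>_. fiber X \<pi> y"] y(2) finite_surj by blast
  show ?thesis
  proof (rule \<tau>.singleton_fiber_exists[OF y(1)])
    fix \<epsilon> :: real assume "\<epsilon> > 0"
    from \<tau>'_contraction[OF subset_refl J \<tau>.fiber_nonempty[OF y(1)] this]
    obtain t where t: "t \<in> carrier T"
      "\<forall>z\<in>fiber Y' \<tau>' y. \<forall>z'\<in>fiber Y' \<tau>' y. dist (\<psi>' t z) (\<psi>' t z') < \<epsilon>" ..
    \<comment> \<open>The fiber over \<open>\<psi> t y\<close> is the translate by \<open>t\<close>
      of the contracted fiber over \<open>y\<close>.\<close>
    have "mdist Y' z z' < \<epsilon>" if z: "z \<in> fiber Y' \<tau>' (\<psi> t y)" "z' \<in> fiber Y' \<tau>' (\<psi> t y)" for z z'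
    proof -
      have "dist (\<psi>' t (\<psi>' (inv t) z)) (\<psi>' t (\<psi>' (inv t) z')) < \<epsilon>"
        using \<tau>.fiber_act_inv[OF t(1) y(1)] z by (intro t(2)[rule_format])
      moreover have "\<psi>' t (\<psi>' (inv t) w) = w" if "w \<in> fiber Y' \<tau>' (\<psi> t y)" for w
        by (rule \<tau>.X.act_inv'[OF t(1)]) (use that in \<open>simp add: fiber_def\<close>)
      ultimately show ?thesis using z by simp
    qed
    then have "\<psi> t y \<in> \<tau>.small_fibers \<epsilon>"
      using Y.act_closed[OF t(1)] y(1) by (auto simp: \<tau>.small_fibers_def)
    then show "\<exists>t\<in>carrier T. \<psi> t y \<in> \<tau>.small_fibers \<epsilon>" using t(1) by blast
  qed (rule that)
qed

text \<open>Forward, a point of \<open>X'\<close> above a point alone in its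
  \<open>\<tau>'\<close>-fiber is alone in its \<open>\<sigma>'\<close>-fiber, by
  \<open>\<sigma>'_\<pi>'_inj\<close>. Backward, a singleton \<open>\<tau>'\<close>-fiber forces the
  \<pi>-fiber below to be the image of a finite \<open>\<pi>'\<close>-fiber.\<close>

lemma almost_finite_to_one_iff:
  "almost_finite_to_one X Y \<pi> \<longleftrightarrow> almost_one_to_one Y' \<tau>' \<and> almost_one_to_one X' \<sigma>'"
proof
  interpret \<tau>: flow_extension T Y' \<psi>' Y \<psi> \<tau>' by (rule \<tau>'_flow_extension)
  interpret \<sigma>: flow_extension T X' \<phi>' X \<phi> \<sigma>' by (rule \<sigma>'_flow_extension)
  assume "almost_finite_to_one X Y \<pi>"
  then obtain z where z: "z \<in> mspace Y'" "fiber Y' \<tau>' (\<tau>' z) = {z}"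
    by (rule \<tau>'_singleton_fiber)
  then have "almost_one_to_one Y' \<tau>'"
    using FY.factor_minimal_flow by (intro \<tau>.almost_one_to_oneI) (simp_all add: minimal_flow_def)
  moreover obtain x where x: "x \<in> mspace X'" "\<pi>' x = z"
    using \<pi>'_extension z(1) unfolding extension_def by (metis imageE)
  have "w = x" if w: "w \<in> fiber X' \<sigma>' (\<sigma>' x)" for w
  proof -
    have w': "w \<in> mspace X'" "\<sigma>' w = \<sigma>' x" using w by (auto simp: fiber_def)
    then have "\<tau>' (\<pi>' w) = \<tau>' z" using commutes[of w] commutes[of x] x by simp
    moreover have "\<pi>' w \<in> mspace Y'" using \<pi>'_extension w'(1) unfolding extension_def by blast
    ultimately have "\<pi>' w = z" using z(2) unfolding fiber_def by blast
    then show ?thesis using \<sigma>'_\<pi>'_inj[OF w'(1) x(1) w'(2)] x(2) by simp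
  qed
  then have "fiber X' \<sigma>' (\<sigma>' x) = {x}" using x(1) by (auto simp: fiber_def)
  then have "almost_one_to_one X' \<sigma>'"
    using x(1) FX.factor_minimal_flow
    by (intro \<sigma>.almost_one_to_oneI) (simp_all add: minimal_flow_def)
  ultimately show "almost_one_to_one Y' \<tau>' \<and> almost_one_to_one X' \<sigma>'" by blast
next
  assume "almost_one_to_one Y' \<tau>' \<and> almost_one_to_one X' \<sigma>'"
  then have "almost_one_to_one Y' \<tau>'" ..
  then obtain X0 where X0: "mtopology_of Y' closure_of X0 = mspace Y'"
    "gdelta_in (mtopology_of Y') X0" "\<forall>z\<in>X0. fiber Y' \<tau>' (\<tau>' z) = {z}"
    unfolding almost_one_to_one_def by (elim exE conjE)
  have "X0 \<noteq> {}" using X0(1) minimal_setD(1)[OF M] unfolding mspace_Y' by auto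
  then obtain z where z: "z \<in> X0" by blast
  then have zY: "z \<in> mspace Y'" using gdelta_in_subset[OF X0(2)] by auto
  \<comment> \<open>Every lift to \<open>X'\<close> of a point of this fiber lies over
    \<open>z\<close>, the only point of \<open>Y'\<close> above \<open>\<tau>' z\<close>.\<close>
  have "fiber X \<pi> (\<tau>' z) \<subseteq> \<sigma>' ` fiber X' \<pi>' z"
  proof
    fix v assume v: "v \<in> fiber X \<pi> (\<tau>' z)"
    then obtain x where x: "x \<in> mspace X'" "v = \<sigma>' x"
      using \<sigma>'_extension unfolding extension_def fiber_def by blast
    have "\<tau>' (\<pi>' x) = \<tau>' z" using commutes[OF x(1)] v x(2) by (simp add: fiber_def)
    moreover have "\<pi>' x \<in> mspace Y'" using \<pi>'_extension x(1) unfolding extension_def by blast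
    ultimately have "\<pi>' x = z" using bspec[OF X0(3) z] unfolding fiber_def by blast
    then show "v \<in> \<sigma>' ` fiber X' \<pi>' z" using x by (auto simp: fiber_def)
  qed
  moreover have "finite (fiber X' \<pi>' z)" using \<pi>'_finite_to_one zY unfolding finite_to_one_def by blast
  ultimately have "finite (fiber X \<pi> (\<tau>' z))" using finite_surj by blast
  moreover have "\<tau>' z \<in> mspace Y" using \<tau>'_extension zY unfolding extension_def by blast
  ultimately show "almost_finite_to_one X Y \<pi>" unfolding almost_finite_to_one_def by blast
qed

end

theorem theorem3p12:
  fixes T :: "('t, 'm) monoid_scheme"
    and X :: "'a metric" and \<phi> :: "'t \<Rightarrow> 'a \<Rightarrow> 'a"
    and Y :: "'b metric" and \<psi> :: "'t \<Rightarrow> 'b \<Rightarrow> 'b"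
    and \<pi> :: "'a \<Rightarrow> 'b"
  assumes "group T" and "infinite (carrier T)" and "countable (carrier T)"
    and "minimal_flow T X \<phi>" and "minimal_flow T Y \<psi>"
    and "extension T X \<phi> Y \<psi> \<pi>"
    and "almost_proximal T X \<phi> Y \<pi>"
  shows "\<exists>(X' :: (nat \<Rightarrow> real) metric) \<phi>' (Y' :: (nat \<Rightarrow> real) metric) \<psi>' \<sigma>' \<tau>' \<pi>'.
    minimal_flow T X' \<phi>' \<and> minimal_flow T Y' \<psi>' \<and>
    extension T X' \<phi>' X \<phi> \<sigma>' \<and> extension T Y' \<psi>' Y \<psi> \<tau>' \<and> extension T X' \<phi>' Y' \<psi>' \<pi>' \<and>
    (\<forall>x\<in>mspace X'. \<pi> (\<sigma>' x) = \<tau>' (\<pi>' x)) \<and>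
    proximal_map T X' \<phi>' \<sigma>' \<and> proximal_map T Y' \<psi>' \<tau>' \<and>
    finite_to_one X' Y' \<pi>' \<and> equicontinuous_map T X' \<phi>' \<pi>' \<and>
    (almost_finite_to_one X Y \<pi> \<longleftrightarrow> almost_one_to_one Y' \<tau>' \<and> almost_one_to_one X' \<sigma>')"
proof -
  interpret group T by fact
  interpret flow_extension T X \<phi> Y \<psi> \<pi>
    using assms by unfold_locales (auto simp: minimal_flow_def)
  obtain y0 N M q where "maximal_almost_periodic T X \<phi> Y \<psi> \<pi> y0 N M q"
    using maximal_almost_periodic_exists assms by blast
  then interpret maximal_almost_periodic T X \<phi> Y \<psi> \<pi> y0 N M q .
  show ?thesis
    using FX.factor_minimal_flow FY.factor_minimal_flow \<sigma>'_extension \<tau>'_extension \<pi>'_extension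
      commutes \<sigma>'_proximal \<tau>'_proximal \<pi>'_finite_to_one \<pi>'_equicontinuous almost_finite_to_one_iff
    by blast
qed

end
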